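(* Let $G$ be a bridgeless mixed graph of order $n$, and let $u\in V(G)$ be any vertex. Then (1) $\overrightarrow{\mathrm{diam}}(G)\le n-d_G^*(u)+3$ if at least one of the following holds: $G$ is undirected (i.e. has no directed edges); or $d_G^+(u)+d_G^-(u)\ge 2$; or $d_G^*(u)=5$ and $d_G^+(u)+d_G^-(u)=1$; (2) $\overrightarrow{\mathrm{diam}}(G)\le n-d_G^*(u)+4$ otherwise.
   Context: A mixed graph $G$ is a finite graph whose edge set may contain both undirected edges $xy$ and directed edges $\overrightarrow{xy}$; its underlying graph (forgetting directions) is assumed simple, so between two vertices there is at most one edge, directed or undirected. For a vertex $x$: $d_G^+(x)$ is the number of directed edges leaving $x$, $d_G^-(x)$ the number of directed edges entering $x$, and $d_G^*(x)$ the number of undirected edges incident with $x$. An orientable path from $x_1$ to $x_k$ is a sequence of distinct vertices $x_1,\dots,x_k$ such that for each $1\le i\le k-1$ either $x_ix_{i+1}$ is an undirected edge or $\overrightarrow{x_ix_{i+1}}$ is a directed edge of $G$. $G$ is connected if for any two vertices $x,y$ there are an orientable path from $x$ to $y$ and one from $y$ to $x$. A bridge is an undirected edge whose deletion disconnects the underlying undirected graph. $G$ is bridgeless if it is connected and has no bridge. An orientation of $G$ assigns a direction to every undirected edge (directed edges keep their direction); it is strong if the resulting directed graph is strongly connected. The distance from $x$ to $y$ in a directed graph is the number of edges of a shortest directed path from $x$ to $y$, and the diameter is the maximum of these distances over all ordered pairs of vertices. The oriented diameter is $\overrightarrow{\mathrm{diam}}(G)=\min\{\mathrm{diam}(\overrightarrow{G}):\overrightarrow{G}\text{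 is a strong orientation of }G\}$. *)

theory Defs
  imports
    "Graph_Theory.Digraph_Component"
    "Graph_Theory.Pair_Digraph"
    "HOL-Library.Extended_Nat"
begin

record 'a pre_mixed_graph =
  mverts :: "'a set"
  medges :: "'a set set"
  marcs :: "'a rel"

text \<open>The last two assumptions, together with the absence of loops, say that the underlying
  graph is simple: no two opposite directed edges, and no directed edge parallel to an
  undirected one.\<close>
locale mixed_graph =
  fixes G :: "'a pre_mixed_graph"
  assumes finite_mverts: "finite (mverts G)"
    and medges_wf: "e \<in> medges G \<Longrightarrow> e \<subseteq> mverts G \<and> card e = 2"
    and marcs_wf: "(x, y) \<in> marcs G \<Longrightarrow> x \<in> mverts G \<and> y \<in> mverts G \<and> x \<noteq> y"
    and no_opposite_marcs: "(x, y) \<in> marcs G \<Longrightarrow> (y, x) \<notin> marcs G"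
    and no_marc_parallel_medge: "(x, y) \<in> marcs G \<Longrightarrow> {x, y} \<notin> medges G"

definition out_arc_degree :: "'a pre_mixed_graph \<Rightarrow> 'a \<Rightarrow> nat" where
  "out_arc_degree G x = card {a \<in> marcs G. fst a = x}"

definition in_arc_degree :: "'a pre_mixed_graph \<Rightarrow> 'a \<Rightarrow> nat" where
  "in_arc_degree G x = card {a \<in> marcs G. snd a = x}"

definition undirected_degree :: "'a pre_mixed_graph \<Rightarrow> 'a \<Rightarrow> nat" where
  "undirected_degree G x = card {e \<in> medges G. x \<in> e}"

definition orientable_path :: "'a pre_mixed_graph \<Rightarrow> 'a \<Rightarrow> 'a list \<Rightarrow> 'a \<Rightarrow> bool" where
  "orientable_path G x p y \<longleftrightarrow>
     p \<noteq> [] \<and> hd p = x \<and> last p = y \<and> distinct p \<and> set p \<subseteq> mverts G \<and>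
     (\<forall>i. Suc i < length p \<longrightarrow>
        {p ! i, p ! Suc i} \<in> medges G \<or> (p ! i, p ! Suc i) \<in> marcs G)"

definition mconnected :: "'a pre_mixed_graph \<Rightarrow> bool" where
  "mconnected G \<longleftrightarrow>
     (\<forall>x \<in> mverts G. \<forall>y \<in> mverts G.
        (\<exists>p. orientable_path G x p y) \<and> (\<exists>p. orientable_path G y p x))"

text \<open>The underlying undirected graph, encoded as a symmetric digraph.\<close>
definition underlying :: "'a pre_mixed_graph \<Rightarrow> 'a pair_pre_digraph" where
  "underlying G =
     \<lparr> pverts = mverts G,
       parcs = {(x, y). {x, y} \<in> medges G \<or> (x, y) \<in> marcs G \<or> (y, x) \<in> marcs G} \<rparr>"

definition delete_medge :: "'a pre_mixed_graph \<Rightarrow> 'a set \<Rightarrow> 'a pre_mixed_graph" where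
  "delete_medge G e = G \<lparr> medges := medges G - {e} \<rparr>"

text \<open>The qualified name avoids a clash with topological connectedness.\<close>
definition bridge :: "'a pre_mixed_graph \<Rightarrow> 'a set \<Rightarrow> bool" where
  "bridge G e \<longleftrightarrow>
     e \<in> medges G \<and>
     Digraph_Component.connected (with_proj (underlying G)) \<and>
     \<not> Digraph_Component.connected (with_proj (underlying (delete_medge G e)))"

definition bridgeless :: "'a pre_mixed_graph \<Rightarrow> bool" where
  "bridgeless G \<longleftrightarrow> mconnected G \<and> (\<nexists>e. bridge G e)"

definition orientation :: "'a pre_mixed_graph \<Rightarrow> 'a pair_pre_digraph \<Rightarrow> bool" where
  "orientation G D \<longleftrightarrow>
     pverts D = mverts G \<and>
     marcs G \<subseteq> parcs D \<and>
     (\<forall>x y. (x, y) \<in> parcs D \<longrightarrow> (x, y) \<in> marcs G \<or> {x, y} \<in> medges G) \<and>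
     (\<forall>x y. {x, y} \<in> medges G \<longrightarrow> ((x, y) \<in> parcs D) \<noteq> ((y, x) \<in> parcs D))"

definition strong_orientation :: "'a pre_mixed_graph \<Rightarrow> 'a pair_pre_digraph \<Rightarrow> bool" where
  "strong_orientation G D \<longleftrightarrow> orientation G D \<and> strongly_connected (with_proj D)"

text \<open>The distance is infinite if there is no directed path.\<close>
definition distance :: "'a pair_pre_digraph \<Rightarrow> 'a \<Rightarrow> 'a \<Rightarrow> enat" where
  "distance D x y = (INF p \<in> {p. pre_digraph.apath (with_proj D) x p y}. enat (length p))"

definition diameter :: "'a pair_pre_digraph \<Rightarrow> enat" where
  "diameter D = (SUP (x, y) \<in> pverts D \<times> pverts D. distance D x y)"

text \<open>The infimum in \<^typ>\<open>enat\<close> is a minimum whenever a strong orientation exists, and is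
  infinite otherwise; so a finite upper bound includes the existence of a strong orientation.\<close>
definition oriented_diameter :: "'a pre_mixed_graph \<Rightarrow> enat" where
  "oriented_diameter G = (INF D \<in> {D. strong_orientation G D}. diameter D)"

text \<open>By this fact, the natural-number difference of the order and the undirected degree of a vertex
  never truncates.\<close>
lemma (in mixed_graph) undirected_degree_less_order:
  assumes "u \<in> mverts G"
  shows "undirected_degree G u < card (mverts G)"
proof -
  have "{e \<in> medges G. u \<in> e} \<subseteq> (\<lambda>v. {u, v}) ` (mverts G - {u})"
  proof
    fix e assume "e \<in> {e \<in> medges G. u \<in> e}"
    then have e: "e \<subseteq> mverts G" "card e = 2" "u \<in> e"
      using medges_wf by auto
    then obtain v where "e = {u, v}" "v \<noteq> u"
      by (auto simp: card_2_iff)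
    with e show "e \<in> (\<lambda>v. {u, v}) ` (mverts G - {u})" by auto
  qed
  then have "undirected_degree G u \<le> card (mverts G - {u})"
    unfolding undirected_degree_def using finite_mverts by (simp add: surj_card_le)
  also have "\<dots> < card (mverts G)"
    using assms finite_mverts by (rule card_Diff1_less[rotated])
  finally show ?thesis .
qed

end

theory Submission
  imports Defs
begin

text \<open>Let \<open>N\<close> be the set of undirected neighbours of \<open>u\<close>, let \<open>d\<close> be its size, and start from any strong
  orientation of the mixed graph; only the edges at \<open>u\<close> are then reversed. If \<open>x\<close> reaches \<open>u\<close>
  inside a vertex set \<open>W\<close> and \<open>u\<close> reaches \<open>y\<close> inside \<open>W'\<close>, the distance from \<open>x\<close> to \<open>y\<close> is less
  than the size of \<open>W \<union> W'\<close>, so it is at most \<open>n - d + k - 1\<close> if \<open>W \<union> W'\<close> meets \<open>N\<close> in \<open>k\<close> vertices.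
  Call \<open>v\<close> linked to \<open>w\<close> (both in \<open>N\<close>) if a directed path leads from \<open>v\<close> to \<open>w\<close> whose inner vertices
  avoid \<open>u\<close> and \<open>N\<close>. If \<open>u\<close> has no arcs, every vertex of \<open>N\<close> takes part in a link, and a minimal
  set of links covering \<open>N\<close> is a forest of stars; directing the edge at a star's centre towards \<open>u\<close>
  whenever some link enters the centre gives \<open>k \<le> 2 + 3\<close>. Arcs at \<open>u\<close> serve as additional exits or
  entrances, and in the favourable cases \<open>W \<union> W'\<close> misses one of their ends or \<open>k \<le> 4\<close>. If \<open>G\<close> is
  undirected, the orientation can be chosen to extend one of a forest in \<open>G - u\<close> whose paths change
  direction exactly at \<open>N\<close>; then every vertex of \<open>N\<close> is linked in the right direction and \<open>k \<le> 2 + 2\<close>.\<close>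

section \<open>Strong orientations of mixed graphs\<close>

lemma rtrancl_redirect:
  assumes "(x, y) \<in> (insert (p, q) S)\<^sup>*" and "(p, q) \<in> S\<^sup>*"
  shows "(x, y) \<in> S\<^sup>*"
proof -
  have "insert (p, q) S \<subseteq> S\<^sup>*" using assms(2) by auto
  then show ?thesis using assms(1) rtrancl_subset_rtrancl by blast
qed

text \<open>If neither end reached the other in \<open>S\<close>, every vertex would be reached in
  \<open>S\<close> from exactly one of them, because it reaches one of them in turn. No pair of
  \<open>S\<close> would join these two classes, so the undirected detour could not leave the class
  of \<open>x\<close>.\<close>

lemma edge_on_closed_walk:
  assumes conn: "\<And>z. z \<in> V \<Longrightarrow> (x, z) \<in> (S \<union> {(x, y), (y, x)})\<^sup>*"
      "\<And>z. z \<in> V \<Longrightarrow> (z, x) \<in> (S \<union> {(x, y), (y, x)})\<^sup>*"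
    and "S \<subseteq> V \<times> V" and "x \<in> V"
    and detour: "(x, y) \<in> (S \<union> S\<inverse>)\<^sup>*"
  shows "(x, y) \<in> S\<^sup>* \<or> (y, x) \<in> S\<^sup>*"
proof (rule ccontr)
  assume neg: "\<not> ?thesis"
  have cover: "(x, z) \<in> S\<^sup>* \<or> (y, z) \<in> S\<^sup>*" if "z \<in> V" for z
    using conn(1)[OF that] by (induction rule: rtrancl_induct) (auto intro: rtrancl_into_rtrancl)
  have ret: "(z, x) \<in> S\<^sup>* \<or> (z, y) \<in> S\<^sup>*" if "z \<in> V" for z
    using conn(2)[OF that] by (induction rule: converse_rtrancl_induct) (auto intro: converse_rtrancl_into_rtrancl)
  have disj: "\<not> ((x, z) \<in> S\<^sup>* \<and> (y, z) \<in> S\<^sup>*)" if "z \<in> V" for z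
    using ret[OF that] neg by (meson rtrancl_trans)
  have "(x, z) \<in> S\<^sup>*" if "(x, z) \<in> (S \<union> S\<inverse>)\<^sup>*" for z
    using that
  proof (induction rule: rtrancl_induct)
    case (step z w)
    show ?case
    proof (cases "(z, w) \<in> S")
      case True
      with step show ?thesis by (meson rtrancl_into_rtrancl)
    next
      case False
      with step have "(w, z) \<in> S" by auto
      then have "w \<in> V" "z \<in> V" using assms(3) by auto
      then show ?thesis using cover[of w] disj[of z] step \<open>(w, z) \<in> S\<close>
        by (meson rtrancl_into_rtrancl)
    qed
  qed auto
  with detour neg show False by blast
qed

text \<open>An undirected edge on no directed closed walk would split the vertices into those
  reachable from either end without it, and so it would be a bridge; every other edge can be directed
  along such a walk.\<close>
lemma mixed_robbins:
  assumes "finite E" "sym E" "R \<inter> E = {}" "R \<subseteq> V \<times> V" "E \<subseteq> V \<times> V" "irrefl E"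
    and "\<And>x y. x \<in> V \<Longrightarrow> y \<in> V \<Longrightarrow> (x, y) \<in> (R \<union> E)\<^sup>*"
    and "\<And>x y. (x, y) \<in> E \<Longrightarrow> (x, y) \<in> (R \<union> R\<inverse> \<union> E - {(x, y), (y, x)})\<^sup>*"
  shows "\<exists>T. R \<subseteq> T \<and> T \<subseteq> R \<union> E \<and> (\<forall>x y. (x, y) \<in> E \<longrightarrow> ((x, y) \<in> T) \<noteq> ((y, x) \<in> T)) \<and>
    (\<forall>x\<in>V. \<forall>y\<in>V. (x, y) \<in> T\<^sup>*)"
  using assms
proof (induction "card E" arbitrary: E R rule: less_induct)
  case (less E R)
  show ?case
  proof (cases "E = {}")
    case True
    with less.prems show ?thesis by (intro exI[of _ R]) auto
  next
    case False
    then obtain x0 y0 where e0: "(x0, y0) \<in> E" by auto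
    define E0 where "E0 = E - {(x0, y0), (y0, x0)}"
    define S where "S = R \<union> E0"
    have e0': "(y0, x0) \<in> E" using e0 less.prems(2) by (auto dest: symD)
    have RE: "R \<union> E = S \<union> {(x0, y0), (y0, x0)}"
      using e0 e0' by (auto simp: S_def E0_def)
    have symE0: "sym E0" using less.prems(2) by (auto simp: E0_def sym_def)
    have "E0\<inverse> = E0" using symE0 by (simp add: sym_conv_converse_eq)
    have "R \<union> R\<inverse> \<union> E - {(x0, y0), (y0, x0)} \<subseteq> S \<union> S\<inverse>"
      by (auto simp: S_def E0_def)
    then have det: "(x0, y0) \<in> (S \<union> S\<inverse>)\<^sup>*"
      using less.prems(8)[OF e0] rtrancl_mono by blast
    have "(x0, y0) \<in> S\<^sup>* \<or> (y0, x0) \<in> S\<^sup>*"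
    proof (rule edge_on_closed_walk[where V = V])
      show "(x0, z) \<in> (S \<union> {(x0, y0), (y0, x0)})\<^sup>*" if "z \<in> V" for z
        using less.prems(7)[of x0 z] less.prems(5) e0 that RE by auto
      show "(z, x0) \<in> (S \<union> {(x0, y0), (y0, x0)})\<^sup>*" if "z \<in> V" for z
        using less.prems(7)[of z x0] less.prems(5) e0 that RE by auto
      show "S \<subseteq> V \<times> V" using less.prems by (auto simp: S_def E0_def)
      show "x0 \<in> V" using e0 less.prems by auto
    qed (rule det)
    \<comment> \<open>The edge is directed from \<open>x\<close> to \<open>y\<close>, since the
      remaining graph leads back from \<open>y\<close> to \<open>x\<close> and thus replaces the
      dropped pair \<open>(y, x)\<close>.\<close>
    then obtain x y where xy: "(x, y) \<in> E" "(y, x) \<in> S\<^sup>*" "{(x0, y0), (y0, x0)} = {(x, y), (y, x)}"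
      using that[of x0 y0] that[of y0 x0] e0 e0' by (auto simp: insert_commute)
    define R' where "R' = insert (x, y) R"
    have yx: "(y, x) \<in> E" using xy less.prems(2) by (auto dest: symD)
    have E0: "E0 = E - {(x, y), (y, x)}" using xy(3) by (simp add: E0_def)
    have "\<exists>T. R' \<subseteq> T \<and> T \<subseteq> R' \<union> E0 \<and> (\<forall>x y. (x, y) \<in> E0 \<longrightarrow> ((x, y) \<in> T) \<noteq> ((y, x) \<in> T)) \<and>
      (\<forall>x\<in>V. \<forall>y\<in>V. (x, y) \<in> T\<^sup>*)"
    proof (rule less.hyps)
      show "card E0 < card E"
        using less.prems(1) e0 by (intro psubset_card_mono) (auto simp: E0_def)
      show "finite E0" "sym E0" "irrefl E0" using less.prems symE0 by (auto simp: E0_def irrefl_def)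
      show "R' \<inter> E0 = {}" using less.prems by (auto simp: R'_def E0)
      show "R' \<subseteq> V \<times> V" "E0 \<subseteq> V \<times> V" using less.prems xy by (auto simp: R'_def E0)
      show "(p, q) \<in> (R' \<union> E0)\<^sup>*" if "p \<in> V" "q \<in> V" for p q
      proof (rule rtrancl_redirect)
        have "R \<union> E \<subseteq> insert (y, x) (R' \<union> E0)" by (auto simp: R'_def E0)
        then show "(p, q) \<in> (insert (y, x) (R' \<union> E0))\<^sup>*"
          using less.prems(7)[OF that] rtrancl_mono by blast
        have "S \<subseteq> R' \<union> E0" by (auto simp: S_def R'_def)
        then show "(y, x) \<in> (R' \<union> E0)\<^sup>*" using xy(2) rtrancl_mono by blast
      qed
      show "(p, q) \<in> (R' \<union> R'\<inverse> \<union> E0 - {(p, q), (q, p)})\<^sup>*" if "(p, q) \<in> E0" for p q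
      proof -
        \<comment> \<open>Directing an edge leaves the symmetric closure unchanged, so the detours
          survive.\<close>
        have "R' \<union> R'\<inverse> \<union> E0 = R \<union> R\<inverse> \<union> E" using xy(1) yx by (auto simp: R'_def E0)
        then show ?thesis using less.prems(8)[of p q] that by (simp add: E0_def)
      qed
    qed
    then obtain T where T: "R' \<subseteq> T" "T \<subseteq> R' \<union> E0"
      "\<forall>x y. (x, y) \<in> E0 \<longrightarrow> ((x, y) \<in> T) \<noteq> ((y, x) \<in> T)" "\<forall>x\<in>V. \<forall>y\<in>V. (x, y) \<in> T\<^sup>*"
      by blast
    have "x \<noteq> y" using xy less.prems(6) by (auto simp: irrefl_def)
    then have "(y, x) \<notin> T" using T(2) yx less.prems(3) by (auto simp: R'_def E0)
    moreover have "(x, y) \<in> T" using T(1) by (auto simp: R'_def)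
    ultimately have "((p, q) \<in> T) \<noteq> ((q, p) \<in> T)" if "(p, q) \<in> E" for p q
    proof (cases "(p, q) \<in> E0")
      case False
      with that have "(p, q) = (x, y) \<or> (p, q) = (y, x)" by (auto simp: E0)
      with \<open>(x, y) \<in> T\<close> \<open>(y, x) \<notin> T\<close> show ?thesis by auto
    qed (use T(3) in blast)
    moreover have "R \<subseteq> T" "T \<subseteq> R \<union> E" using T(1,2) xy(1) by (auto simp: R'_def E0)
    ultimately show ?thesis using T(4) by blast
  qed
qed

section \<open>Reachability inside a vertex set\<close>

text \<open>Paths are recorded only through a vertex set containing them: a shortest path inside
  \<open>W\<close> has fewer than \<open>card W\<close> arcs, and concatenation is a union of sets,
  even if the two pieces share vertices.\<close>

definition via :: "'a rel \<Rightarrow> 'a set \<Rightarrow> 'a \<Rightarrow> 'a \<Rightarrow> bool" where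
  "via R W x y \<longleftrightarrow> x \<in> W \<and> y \<in> W \<and> (x, y) \<in> (R \<inter> W \<times> W)\<^sup>*"

lemma via_refl: "via R {x} x x"
  by (simp add: via_def)

lemma via_mono:
  assumes "via R W x y" "R \<subseteq> R'" "W \<subseteq> W'"
  shows "via R' W' x y"
proof -
  have "R \<inter> W \<times> W \<subseteq> R' \<inter> W' \<times> W'" using assms by auto
  then show ?thesis using assms rtrancl_mono unfolding via_def by blast
qed

lemma via_trans:
  assumes "via R W x y" "via R W' y z"
  shows "via R (W \<union> W') x z"
  using via_mono[OF assms(1) subset_refl, of "W \<union> W'"] via_mono[OF assms(2) subset_refl, of "W \<union> W'"]
  unfolding via_def by (auto intro: rtrancl_trans)

lemma via_step: "(x, y) \<in> R \<Longrightarrow> via R {x, y} x y"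
  by (auto simp: via_def)

lemma via_converse: "via (R\<inverse>) W x y \<longleftrightarrow> via R W y x"
proof -
  have "R\<inverse> \<inter> W \<times> W = (R \<inter> W \<times> W)\<inverse>" by auto
  then show ?thesis by (auto simp: via_def rtrancl_converse)
qed

text \<open>Every vertex on a walk from \<open>x\<close> to \<open>y\<close> is reachable from
  \<open>x\<close> and reaches \<open>y\<close>. Applied to a suitably restricted relation
  \<open>R\<close>, this makes the confining set avoid unwanted vertices.\<close>

lemma via_between:
  assumes "(x, y) \<in> R\<^sup>*"
  shows "via R {q. (x, q) \<in> R\<^sup>* \<and> (q, y) \<in> R\<^sup>*} x y"
proof -
  let ?W = "{q. (x, q) \<in> R\<^sup>* \<and> (q, y) \<in> R\<^sup>*}"
  have "(q, y) \<in> R\<^sup>* \<longrightarrow> (x, q) \<in> (R \<inter> ?W \<times> ?W)\<^sup>*" if "(x, q) \<in> R\<^sup>*" for q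
    using that
  proof (induction rule: rtrancl_induct)
    case (step p q)
    show ?case
    proof
      assume q: "(q, y) \<in> R\<^sup>*"
      then have "(p, y) \<in> R\<^sup>*" using step by (meson converse_rtrancl_into_rtrancl)
      moreover have "(x, q) \<in> R\<^sup>*" using step by (meson rtrancl_into_rtrancl)
      ultimately have "(p, q) \<in> R \<inter> ?W \<times> ?W" using step q by auto
      then show "(x, q) \<in> (R \<inter> ?W \<times> ?W)\<^sup>*"
        using step.IH \<open>(p, y) \<in> R\<^sup>*\<close> by (meson rtrancl_into_rtrancl)
    qed
  qed auto
  then show ?thesis using assms unfolding via_def by auto
qed

lemma rtrancl_first_hit:
  assumes "(x, y) \<in> R\<^sup>*" "y \<in> S"
  shows "\<exists>z\<in>S. (x, z) \<in> {(p, q) \<in> R. p \<notin> S}\<^sup>*"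
  using assms
proof (induction rule: converse_rtrancl_induct)
  case (step p q)
  then obtain z where "z \<in> S" "(q, z) \<in> {(p, q) \<in> R. p \<notin> S}\<^sup>*" by auto
  moreover have "(p, z) \<in> {(p, q) \<in> R. p \<notin> S}\<^sup>*" if "p \<notin> S"
    using that step(1) calculation(2) by (intro converse_rtrancl_into_rtrancl[of p q]) auto
  ultimately show ?case by (cases "p \<in> S") auto
qed auto

lemma rtrancl_Range: "(x, z) \<in> R\<^sup>* \<Longrightarrow> z = x \<or> z \<in> Range R"
  by (auto elim: rtranclE)

lemma rtrancl_Domain: "(x, z) \<in> R\<^sup>* \<Longrightarrow> x = z \<or> x \<in> Domain R"
  by (auto elim: converse_rtranclE)

section \<open>Reorienting the edges at a vertex\<close>

locale hub =
  fixes V :: "'a set" and T :: "'a rel" and u :: 'a and N :: "'a set"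
  assumes finite_V: "finite V" and T_V: "T \<subseteq> V \<times> V"
    and strong: "x \<in> V \<Longrightarrow> y \<in> V \<Longrightarrow> (x, y) \<in> T\<^sup>*"
    and u_V: "u \<in> V" and N_V: "N \<subseteq> V - {u}"
    and antisym_u: "(u, v) \<in> T \<Longrightarrow> (v, u) \<notin> T"
begin

text \<open>\<open>N\<close> holds the vertices whose edge to \<open>u\<close> may be reversed; the arcs between \<open>u\<close> and
  \<open>Nin\<close> or \<open>Nout\<close> are fixed. The vertices of \<open>Pin\<close> reach \<open>u\<close>, and those of \<open>Pout\<close> are reached from
  \<open>u\<close>, through a fixed arc and no further vertex of \<open>N\<close>, whatever the orientation of the edges at
  \<open>u\<close>.\<close>
definition F :: "'a rel" where
  "F = {(p, q) \<in> T. p \<noteq> u \<and> q \<noteq> u}"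

text \<open>Only the heads of arcs have to avoid \<open>N\<close>, so the start may lie in
  \<open>N\<close>, and no other vertex of the set does. Dually, \<open>bwd\<close> restricts the
  tails.\<close>

definition fwd :: "'a \<Rightarrow> 'a set" where
  "fwd x = {z. (x, z) \<in> {(p, q) \<in> F. q \<notin> N}\<^sup>*}"

definition bwd :: "'a \<Rightarrow> 'a set" where
  "bwd y = {z. (z, y) \<in> {(p, q) \<in> F. p \<notin> N}\<^sup>*}"

definition Nin :: "'a set" where
  "Nin = {w. (w, u) \<in> T \<and> w \<notin> N}"

definition Nout :: "'a set" where
  "Nout = {w. (u, w) \<in> T \<and> w \<notin> N}"

definition Pin :: "'a set" where
  "Pin = {v \<in> N. fwd v \<inter> Nin \<noteq> {}}"

definition Pout :: "'a set" where
  "Pout = {v \<in> N. bwd v \<inter> Nout \<noteq> {}}"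

definition link :: "'a \<Rightarrow> 'a \<Rightarrow> bool" where
  "link v w \<longleftrightarrow> v \<in> N \<and> w \<in> N \<and> v \<noteq> w \<and> (\<exists>p\<in>fwd v. (p, w) \<in> F)"

definition reorient :: "'a set \<Rightarrow> 'a rel" where
  "reorient A = F \<union> Nin \<times> {u} \<union> {u} \<times> Nout \<union> {u} \<times> A \<union> (N - A) \<times> {u}"

section \<open>Reversal of all arcs\<close>

text \<open>The assumptions are symmetric under reversal, so every fact about reaching
  \<open>u\<close> has a dual about being reached from \<open>u\<close>; \<open>dual_simps\<close>
  translates the derived notions.\<close>

lemma hub_converse: "hub V (T\<inverse>) u N"
  using finite_V T_V strong u_V N_V antisym_u
  by unfold_locales (auto simp: rtrancl_converse)

lemma dual_F: "hub.F (T\<inverse>) u = F\<inverse>"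
  unfolding F_def hub.F_def[OF hub_converse] by auto

lemma dual_fwd: "hub.fwd (T\<inverse>) u N = bwd"
proof
  fix y
  have "{(p, q) \<in> F\<inverse>. q \<notin> N} = {(p, q) \<in> F. p \<notin> N}\<inverse>" by auto
  then show "hub.fwd (T\<inverse>) u N y = bwd y"
    by (simp add: hub.fwd_def[OF hub_converse] bwd_def dual_F rtrancl_converse)
qed

lemma dual_bwd: "hub.bwd (T\<inverse>) u N = fwd"
proof
  fix y
  have "{(p, q) \<in> F\<inverse>. p \<notin> N} = {(p, q) \<in> F. q \<notin> N}\<inverse>" by auto
  then show "hub.bwd (T\<inverse>) u N y = fwd y"
    by (simp add: hub.bwd_def[OF hub_converse] fwd_def dual_F rtrancl_converse)
qed

lemma dual_Nin: "hub.Nin (T\<inverse>) u N = Nout"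
  by (simp add: hub.Nin_def[OF hub_converse] Nout_def)

lemma dual_Nout: "hub.Nout (T\<inverse>) u N = Nin"
  by (simp add: hub.Nout_def[OF hub_converse] Nin_def)

lemma dual_reorient:
  assumes "A \<subseteq> N"
  shows "hub.reorient (T\<inverse>) u N A = (reorient (N - A))\<inverse>"
  using assms
  by (auto simp: hub.reorient_def[OF hub_converse] reorient_def dual_F dual_Nin dual_Nout)

lemmas dual_simps = dual_F dual_fwd dual_bwd dual_Nin dual_Nout via_converse

lemma F_V: "F \<subseteq> (V - {u}) \<times> (V - {u})"
  using T_V by (auto simp: F_def)

lemma Nin_V: "Nin \<subseteq> V - {u}" and Nout_V: "Nout \<subseteq> V - {u}"
  using T_V antisym_u by (auto simp: Nin_def Nout_def)

lemma Nin_N: "Nin \<inter> N = {}" and Nout_N: "Nout \<inter> N = {}"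
  by (auto simp: Nin_def Nout_def)

lemma fwd_self: "x \<in> fwd x" and bwd_self: "x \<in> bwd x"
  by (auto simp: fwd_def bwd_def)

lemma fwd_N: "fwd x \<inter> N \<subseteq> {x}"
  by (auto simp: fwd_def dest!: rtrancl_Range)

lemma fwd_V: "x \<in> V - {u} \<Longrightarrow> fwd x \<subseteq> V - {u}"
  using F_V by (auto simp: fwd_def dest!: rtrancl_Range)

lemma fwd_imp_bwd:
  assumes "p \<in> fwd x" "x \<notin> N"
  shows "x \<in> bwd p"
proof -
  have "(x, p) \<in> {(p, q) \<in> F. q \<notin> N}\<^sup>*" using assms(1) by (simp add: fwd_def)
  then have "p \<notin> N \<and> x \<in> bwd p"
    using assms(2)
    by (induction rule: rtrancl_induct) (auto simp: bwd_def intro: rtrancl_into_rtrancl)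
  then show ?thesis ..
qed

lemma bwd_trans: "x \<in> bwd y \<Longrightarrow> y \<in> bwd z \<Longrightarrow> x \<in> bwd z"
  unfolding bwd_def mem_Collect_eq by (rule rtrancl_trans)

lemma fwd_trans: "y \<in> fwd x \<Longrightarrow> fwd y \<subseteq> fwd x"
  unfolding fwd_def by (blast intro: rtrancl_trans)

section \<open>Paths with few vertices in \<open>N\<close>\<close>

text \<open>The relation \<open>r\<close> has no step that leaves \<open>z\<close> or enters another
  vertex of \<open>N\<close>, which cuts the walk at its first visit to \<open>z\<close>; the
  vertices between \<open>x\<close> and \<open>z\<close> then meet \<open>N\<close> at most in the
  ends. The final inclusion later decides whether such a path can meet \<open>Nin\<close> or
  \<open>Nout\<close>.\<close>

lemma path_to_N:
  assumes "p \<in> fwd x" "(p, z) \<in> F" "z \<in> N"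
  obtains W where "W \<subseteq> V - {u}" "via F W x z" "W \<inter> N \<subseteq> {x, z}" "W - N \<subseteq> fwd x \<inter> bwd z"
proof -
  define r where "r = {(p, q) \<in> F. p \<noteq> z \<and> (q \<notin> N \<or> q = z)}"
  define W where "W = {q. (x, q) \<in> r\<^sup>* \<and> (q, z) \<in> r\<^sup>*}"
  let ?r = "{(p, q) \<in> F. q \<notin> N \<or> q = z}"
  have "{(p, q) \<in> F. q \<notin> N} \<subseteq> ?r" by auto
  then have "(x, p) \<in> ?r\<^sup>*" using assms(1) rtrancl_mono by (auto simp: fwd_def)
  then have "(x, z) \<in> ?r\<^sup>*" using assms(2) by (auto intro: rtrancl_into_rtrancl)
  moreover have "{(p, q) \<in> ?r. p \<notin> {z}} = r" by (auto simp: r_def)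
  ultimately have xz: "(x, z) \<in> r\<^sup>*" using rtrancl_first_hit[of x z ?r "{z}"] by simp
  have "x \<in> V - {u}"
    using assms F_V by (auto simp: fwd_def dest!: rtrancl_Domain)
  show thesis
  proof
    show "via F W x z"
      using via_between[OF xz] by (auto simp: W_def r_def intro: via_mono)
    show "W \<subseteq> V - {u}"
    proof
      fix q assume "q \<in> W"
      then have "(x, q) \<in> r\<^sup>*" by (simp add: W_def)
      then show "q \<in> V - {u}"
        using \<open>x \<in> V - {u}\<close> F_V by (auto simp: r_def dest!: rtrancl_Range)
    qed
    show "W \<inter> N \<subseteq> {x, z}"
      by (auto simp: W_def r_def dest!: rtrancl_Range)
    show "W - N \<subseteq> fwd x \<inter> bwd z"
    proof
      fix q assume q: "q \<in> W - N"
      then have "(x, q) \<in> r\<^sup>*" by (simp add: W_def)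
      then have "q \<noteq> z \<longrightarrow> q \<in> fwd x"
        by (induction rule: rtrancl_induct) (auto simp: fwd_def r_def intro: rtrancl_into_rtrancl)
      moreover from q have "(q, z) \<in> r\<^sup>*" by (simp add: W_def)
      then have "q \<notin> N \<longrightarrow> q \<in> bwd z"
        by (induction rule: converse_rtrancl_induct)
          (auto simp: bwd_def r_def intro: converse_rtrancl_into_rtrancl)
      ultimately show "q \<in> fwd x \<inter> bwd z" using q assms(3) by auto
    qed
  qed
qed

lemma link_path:
  assumes "link v w"
  obtains W where "W \<subseteq> V - {u}" "via F W v w" "W \<inter> N \<subseteq> {v, w}" "W - N \<subseteq> fwd v \<inter> bwd w"
  using assms path_to_N unfolding link_def by metis

text \<open>The path stops at its first vertex in \<open>Nin\<close>. So it meets \<open>Nin\<close>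
  only once, and any further vertex of \<open>Nin\<close> counts as missed.\<close>

lemma path_to_Nin:
  assumes "fwd x \<inter> Nin \<noteq> {}" "x \<in> V - {u}"
  obtains W i where "W \<subseteq> V - {u}" "i \<in> Nin" "via F W x i" "W \<inter> N \<subseteq> {x}" "W \<inter> Nin \<subseteq> {i}"
    "\<And>q. q \<in> W \<Longrightarrow> i \<in> fwd q"
proof -
  define r where "r = {(p, q). ((p, q) \<in> F \<and> q \<notin> N) \<and> p \<notin> Nin}"
  obtain i where i: "i \<in> Nin" "(x, i) \<in> r\<^sup>*"
    using assms(1) rtrancl_first_hit[of x _ "{(p, q). (p, q) \<in> F \<and> q \<notin> N}" Nin]
    by (auto simp: fwd_def r_def)
  define W where "W = {q. (x, q) \<in> r\<^sup>* \<and> (q, i) \<in> r\<^sup>*}"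
  show thesis
  proof
    show "i \<in> Nin" by fact
    show "via F W x i"
      using via_between[OF i(2)] by (auto simp: W_def r_def intro: via_mono)
    show "W \<subseteq> V - {u}"
    proof
      fix q assume "q \<in> W"
      then have "(x, q) \<in> r\<^sup>*" by (simp add: W_def)
      then show "q \<in> V - {u}"
        using assms(2) F_V by (auto simp: r_def dest!: rtrancl_Range)
    qed
    show "W \<inter> N \<subseteq> {x}"
      by (auto simp: W_def r_def dest!: rtrancl_Range)
    show "W \<inter> Nin \<subseteq> {i}"
      by (auto simp: W_def r_def dest!: rtrancl_Domain)
    show "i \<in> fwd q" if "q \<in> W" for q
    proof -
      have "r \<subseteq> {(p, q) \<in> F. q \<notin> N}" by (auto simp: r_def)
      then show ?thesis using that rtrancl_mono by (auto simp: W_def fwd_def)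
    qed
  qed
qed

section \<open>Exits, entrances and links forced by strong connectivity\<close>

text \<open>If all alternatives failed, everything reachable from \<open>x\<close> would lie in
  \<open>fwd x\<close>, which misses \<open>u\<close>; this contradicts strong connectivity.\<close>

lemma reach_hub:
  assumes "x \<in> V - {u}"
  obtains "fwd x \<inter> Nin \<noteq> {}" | "x \<in> N" "(x, u) \<in> T"
    | p z where "z \<in> N" "z \<noteq> x" "p \<in> fwd x" "(p, z) \<in> F"
proof (rule ccontr)
  assume neg: "\<not> thesis"
  note alt = that
  have "p \<in> fwd x" if "(x, p) \<in> T\<^sup>*" for p
    using that
  proof (induction rule: rtrancl_induct)
    case base
    show ?case by (rule fwd_self)
  next
    case (step p q)
    have "q \<noteq> u"
    proof
      assume "q = u"
      with step have "p \<in> Nin \<or> p = x \<and> x \<in> N \<and> (x, u) \<in> T"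
        using fwd_N[of x] by (auto simp: Nin_def)
      moreover have "p \<notin> Nin" using step.IH alt(1) neg by blast
      ultimately show False using alt(2) neg by blast
    qed
    moreover have "p \<noteq> u" using step assms fwd_V by blast
    ultimately have "(p, q) \<in> F" using step by (simp add: F_def)
    show ?case
    proof (cases "q \<in> N")
      case True
      then have "q = x" using alt(3)[of q p] step \<open>(p, q) \<in> F\<close> neg by blast
      then show ?thesis by (simp add: fwd_self)
    next
      case False
      then show ?thesis using step \<open>(p, q) \<in> F\<close>
        by (auto simp: fwd_def intro: rtrancl_into_rtrancl)
    qed
  qed
  then have "u \<in> fwd x" using strong[of x u] assms u_V by blast
  then show False using fwd_V[OF assms] by auto
qed

lemma reach_from_hub:
  assumes "y \<in> V - {u}"
  obtains "bwd y \<inter> Nout \<noteq> {}" | "y \<in> N" "(u, y) \<in> T"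
    | q z where "z \<in> N" "z \<noteq> y" "q \<in> bwd y" "(z, q) \<in> F"
  using hub.reach_hub[OF hub_converse, of y thesis] assms by (simp add: dual_simps)

text \<open>The definition of \<open>link\<close> splits off the last arc of a path, whereas the
  dual of \<open>reach_hub\<close> splits off the first. The inner vertices avoid \<open>N\<close>
  in either description.\<close>

lemma linkI_from:
  assumes "z \<in> N" "v \<in> N" "z \<noteq> v" "q \<in> bwd v" "(z, q) \<in> F"
  shows "link z v"
proof (cases "q = v")
  case True
  with assms show ?thesis by (auto simp: link_def intro: fwd_self)
next
  case False
  obtain p where p: "(p, v) \<in> F" "p \<notin> N" "q \<in> bwd p"
  proof -
    have "(q, v) \<in> {(p, q) \<in> F. p \<notin> N}\<^sup>*" using assms(4) by (simp add: bwd_def)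
    then show thesis
      by (cases rule: rtranclE) (use False that in \<open>auto simp: bwd_def\<close>)
  qed
  then have "q \<notin> N" by (auto simp: bwd_def dest!: rtrancl_Domain)
  have "(q, p) \<in> {(p, q) \<in> F. p \<notin> N}\<^sup>*" using p by (simp add: bwd_def)
  then have "p \<in> fwd z" using p(2)
  proof (induction rule: rtrancl_induct)
    case base
    then show ?case using assms(5) \<open>q \<notin> N\<close> by (auto simp: fwd_def)
  next
    case (step a b)
    then show ?case by (auto simp: fwd_def intro: rtrancl_into_rtrancl)
  qed
  then show ?thesis using assms p by (auto simp: link_def)
qed

text \<open>Without links and fixed arcs, \<open>v\<close> could reach \<open>u\<close> and be
  reached from \<open>u\<close> only through its own edge, which would have to be directed both
  ways.\<close>

lemma linked:
  assumes "v \<in> N" "v \<notin> Pin" "v \<notin> Pout"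
  shows "\<exists>w. link v w \<or> link w v"
proof (rule ccontr)
  assume neg: "\<not> ?thesis"
  have v: "v \<in> V - {u}" using assms N_V by auto
  have "(v, u) \<in> T"
    using v
  proof (rule reach_hub)
    show ?thesis if "fwd v \<inter> Nin \<noteq> {}" using that assms by (simp add: Pin_def)
    show ?thesis if "z \<in> N" "z \<noteq> v" "p \<in> fwd v" "(p, z) \<in> F" for p z
      using that assms neg unfolding link_def by blast
  qed
  moreover have "(u, v) \<in> T"
    using v
  proof (rule reach_from_hub)
    show ?thesis if "bwd v \<inter> Nout \<noteq> {}" using that assms by (simp add: Pout_def)
    show ?thesis if "z \<in> N" "z \<noteq> v" "q \<in> bwd v" "(z, q) \<in> F" for q z
      using that linkI_from assms neg by blast
  qed
  ultimately show False using antisym_u by blast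
qed

lemma path_from_Nout:
  assumes "bwd y \<inter> Nout \<noteq> {}" "y \<in> V - {u}"
  obtains W o' where "W \<subseteq> V - {u}" "o' \<in> Nout" "via F W o' y" "W \<inter> N \<subseteq> {y}"
proof (rule hub.path_to_Nin[OF hub_converse, of y])
  show "hub.fwd (T\<inverse>) u N y \<inter> hub.Nin (T\<inverse>) u N \<noteq> {}" "y \<in> V - {u}"
    using assms by (simp_all add: dual_simps)
qed (use that in \<open>simp add: dual_simps\<close>)

lemma via_F:
  assumes "via F W x y"
  shows "via (reorient A) W x y"
  using assms by (rule via_mono) (auto simp: reorient_def)

lemma in_hub: "v \<in> N - A \<or> v \<in> Nin \<Longrightarrow> via (reorient A) {v, u} v u"
  and out_hub: "v \<in> A \<or> v \<in> Nout \<Longrightarrow> via (reorient A) {u, v} u v"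
  by (auto simp: reorient_def intro!: via_step)

section \<open>First and last vertices in \<open>N\<close> on a route\<close>

text \<open>The segment of a route up to its first vertex in \<open>N\<close> does not depend on
  \<open>A\<close>. For \<open>x\<close> outside \<open>N\<close> an exit through \<open>Nin\<close>
  is preferred if \<open>fwd x\<close> meets \<open>Nin\<close>; the segments that remain therefore
  avoid \<open>Nin\<close>, which helps to find missed vertices later.\<close>

lemma first_N:
  assumes "x \<in> V"
  shows "(\<exists>W\<subseteq>V. via (reorient A) W x u \<and> W \<inter> N = {}) \<or>
    (\<exists>z\<in>N. \<exists>W\<subseteq>V. via F W x z \<and> W \<inter> N \<subseteq> {z} \<and> W \<inter> Nin = {} \<and> W \<inter> Nout \<subseteq> bwd z \<and>
      (\<forall>q\<in>W \<inter> Nout. fwd q \<inter> Nin = {}))"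
proof -
  consider "x = u" | "x \<in> N" | "x \<in> V - {u} - N" using assms by auto
  then show ?thesis
  proof cases
    case 1
    then show ?thesis using u_V N_V by (intro disjI1 exI[of _ "{u}"]) (auto intro: via_refl)
  next
    case 2
    then show ?thesis using assms Nin_N Nout_N
      by (intro disjI2 bexI[of _ x] exI[of _ "{x}"]) (auto intro: via_refl)
  next
    case 3
    show ?thesis
    proof (cases "fwd x \<inter> Nin = {}")
      case False
      then obtain W i where W: "W \<subseteq> V - {u}" "i \<in> Nin" "via F W x i" "W \<inter> N \<subseteq> {x}"
        using path_to_Nin[of x] 3 by (metis DiffD1)
      have "via (reorient A) (W \<union> {i, u}) x u"
        using via_trans[OF via_F[OF W(3)] in_hub] W(2) by simp
      moreover have "(W \<union> {i, u}) \<inter> N = {}" using W 3 N_V Nin_N by auto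
      moreover have "W \<union> {i, u} \<subseteq> V" using W Nin_V u_V by auto
      ultimately show ?thesis by blast
    next
      case True
      obtain p z where "z \<in> N" "p \<in> fwd x" "(p, z) \<in> F"
      proof (rule reach_hub)
        show "x \<in> V - {u}" using 3 by simp
      qed (use 3 True in auto)
      then obtain W where W: "W \<subseteq> V - {u}" "via F W x z" "W \<inter> N \<subseteq> {x, z}" "W - N \<subseteq> fwd x \<inter> bwd z"
        using path_to_N by metis
      have "fwd q \<inter> Nin = {}" if "q \<in> W \<inter> Nout" for q
      proof -
        have "q \<in> fwd x" using that W(4) Nout_N by blast
        then have "fwd q \<subseteq> fwd x" by (rule fwd_trans)
        then show ?thesis using True by blast
      qed
      moreover have "W \<inter> N \<subseteq> {z}" using W 3 by auto
      moreover have "W \<inter> Nin = {}" "W \<inter> Nout \<subseteq> bwd z" using W(4) True Nin_N Nout_N by auto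
      moreover have "W \<subseteq> V" using W(1) by auto
      ultimately show ?thesis using W(2) \<open>z \<in> N\<close>
        by (intro disjI2 bexI[of _ z] exI[of _ W]) simp_all
    qed
  qed
qed

lemma last_N:
  assumes "y \<in> V" "A \<subseteq> N"
  shows "(\<exists>W\<subseteq>V. via (reorient A) W u y \<and> W \<inter> N = {}) \<or>
    (\<exists>z\<in>N. \<exists>W\<subseteq>V. via F W z y \<and> W \<inter> N \<subseteq> {z} \<and> W \<inter> Nout = {} \<and> W \<inter> Nin \<subseteq> fwd z \<and>
      (\<forall>q\<in>W \<inter> Nin. bwd q \<inter> Nout = {}))"
proof -
  \<comment> \<open>Reversal exchanges \<open>A\<close> and its complement in
    \<open>N\<close>.\<close>
  have "N - (N - A) = A" using assms(2) by auto
  then show ?thesis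
    using hub.first_N[OF hub_converse assms(1), of "N - A"] dual_reorient[of "N - A"]
    by (simp add: dual_simps)
qed

section \<open>Covering \<open>N\<close> by stars of links\<close>

text \<open>\<open>P\<close> consists of vertices already served by the fixed arcs. In a minimal set of links
  covering \<open>N - P\<close> every link has an end in \<open>N - P\<close> that lies on no other link, so a vertex with an
  entering and a leaving link is the centre of a star.\<close>
definition star_split :: "'a set \<Rightarrow> 'a set \<Rightarrow> bool" where
  "star_split P A \<longleftrightarrow> A \<subseteq> N \<and> A \<inter> P = P - Pout \<and>
    (\<forall>v\<in>A - P. \<exists>w. link v w \<and> (w \<notin> A \<or> w \<in> P - Pout)) \<and>
    (\<forall>v\<in>N - A. v \<in> Pout \<or> (\<exists>z. link z v \<and> (z \<in> A \<or> z \<in> Pout)) \<or>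
      (\<exists>a c. link a c \<and> link c v \<and> a \<in> A \<and> {a, c, v} \<inter> P = {}))"

lemma star_split_subset: "star_split P A \<Longrightarrow> A \<subseteq> N"
  by (simp add: star_split_def)

lemma ex_star_split:
  assumes "Pout \<subseteq> P" "P \<subseteq> Pout \<union> Pin" "\<And>v. v \<in> N - P \<Longrightarrow> \<exists>w. link v w \<or> link w v"
  shows "\<exists>A. star_split P A"
proof -
  define L where "L = {(v, w). link v w}"
  define covers where "covers E \<longleftrightarrow> (\<forall>v\<in>N - P. \<exists>e\<in>E. v = fst e \<or> v = snd e)" for E
  have "L \<subseteq> N \<times> N" by (auto simp: L_def link_def)
  moreover have "finite N" using N_V finite_V finite_subset by blast
  ultimately have "finite L" using finite_subset by blast
  have "covers L" using assms(3) by (fastforce simp: covers_def L_def)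
  then obtain E where E: "E \<subseteq> L" "covers E" "\<And>E'. E' \<subseteq> L \<Longrightarrow> covers E' \<Longrightarrow> card E \<le> card E'"
    using ex_has_least_nat[of "\<lambda>E. E \<subseteq> L \<and> covers E" L card] by auto
  have linkE: "link v w" if "(v, w) \<in> E" for v w using that E(1) by (auto simp: L_def)
  have "finite E" using E(1) \<open>finite L\<close> finite_subset by blast
  have critical: "\<exists>m\<in>N - P. (m = fst e \<or> m = snd e) \<and> (\<forall>e'\<in>E. m = fst e' \<or> m = snd e' \<longrightarrow> e' = e)"
    if "e \<in> E" for e
  proof -
    have "card (E - {e}) < card E" using that \<open>finite E\<close> by (rule card_Diff1_less[rotated])
    then have "\<not> covers (E - {e})" using E(1,3) by (meson Diff_subset leD subset_trans)
    then obtain m where m: "m \<in> N - P" "\<forall>e'\<in>E - {e}. m \<noteq> fst e' \<and> m \<noteq> snd e'"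
      by (auto simp: covers_def)
    moreover obtain e' where "e' \<in> E" "m = fst e' \<or> m = snd e'"
      using E(2) m(1) unfolding covers_def by blast
    ultimately have "m = fst e \<or> m = snd e" by blast
    with m show ?thesis by blast
  qed
  \<comment> \<open>Vertices of \<open>P - Pout\<close> have a fixed exit and those entered by no
    chosen link need an entrance, so \<open>u\<close> points to both; the rest can be reached by
    links or fixed arcs and points to \<open>u\<close>.\<close>
  define A where "A = (P - Pout) \<union> {v \<in> N - P. \<forall>z. (z, v) \<notin> E}"
  have "P \<subseteq> N" using assms(2) by (auto simp: Pin_def Pout_def)
  have "star_split P A"
    unfolding star_split_def
  proof (intro conjI ballI)
    show "A \<subseteq> N" "A \<inter> P = P - Pout" using \<open>P \<subseteq> N\<close> by (auto simp: A_def)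
    show "\<exists>w. link v w \<and> (w \<notin> A \<or> w \<in> P - Pout)" if "v \<in> A - P" for v
    proof -
      have "v \<in> N - P" "\<forall>z. (z, v) \<notin> E" using that by (auto simp: A_def)
      then obtain w where "(v, w) \<in> E" using E(2) by (force simp: covers_def)
      then show ?thesis using linkE by (auto simp: A_def)
    qed
    show "v \<in> Pout \<or> (\<exists>z. link z v \<and> (z \<in> A \<or> z \<in> Pout)) \<or>
      (\<exists>a c. link a c \<and> link c v \<and> a \<in> A \<and> {a, c, v} \<inter> P = {})" if v: "v \<in> N - A" for v
    proof (cases "v \<in> P")
      case True
      then show ?thesis using v by (auto simp: A_def)
    next
      case False
      then obtain z where z: "(z, v) \<in> E" using v by (auto simp: A_def)
      show ?thesis
      proof (cases "z \<in> A \<or> z \<in> P")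
        case True
        then show ?thesis using linkE[OF z] by (auto simp: A_def)
      next
        case zA: False
        have "z \<in> N" using linkE[OF z] by (simp add: link_def)
        then obtain y where y: "(y, z) \<in> E" using zA by (auto simp: A_def)
        have ne: "y \<noteq> z" "z \<noteq> v" using linkE[OF y] linkE[OF z] by (auto simp: link_def)
        \<comment> \<open>The vertex \<open>z\<close> lies on two chosen links, so the private end
          of \<open>(y, z)\<close> must be \<open>y\<close>; hence no link of \<open>E\<close>
          enters \<open>y\<close>, and \<open>y\<close> belongs to \<open>A\<close>.\<close>
        obtain m where m: "m \<in> N - P" "m = y \<or> m = z" "\<forall>e'\<in>E. m = fst e' \<or> m = snd e' \<longrightarrow> e' = (y, z)"
          using critical[OF y] by auto
        have "m = y"
        proof (rule ccontr)
          assume "m \<noteq> y"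
          then have "(z, v) = (y, z)" using m z by (metis fst_conv)
          then show False using ne by simp
        qed
        moreover have "(q, y) \<notin> E" for q
        proof
          assume "(q, y) \<in> E"
          then have "(q, y) = (y, z)" using m \<open>m = y\<close> by (metis snd_conv)
          then show False using ne by simp
        qed
        ultimately have "y \<in> A" "y \<notin> P" using m by (auto simp: A_def)
        then show ?thesis using linkE[OF y] linkE[OF z] False zA by blast
      qed
    qed
  qed
  then show ?thesis ..
qed

lemma finite_N: "finite N"
  using N_V finite_V finite_subset by blast

section \<open>Routes to and from \<open>u\<close>\<close>

text \<open>The first outcome uses the edge of \<open>v\<close> itself or a fixed exit, the second a
  link to a vertex outside \<open>A\<close>, the third a link to a vertex of \<open>P - Pout\<close>
  followed by its fixed exit. The side conditions record which fixed neighbours of \<open>u\<close>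
  the route may meet.\<close>

lemma N_to_hub:
  assumes "star_split P A" "P \<subseteq> Pout \<union> Pin"
    and v: "v \<in> N"
  obtains W where "W \<subseteq> V" "via (reorient A) W v u" "W \<inter> N \<subseteq> {v}"
  | W w where "W \<subseteq> V" "via (reorient A) W v u" "W \<inter> N \<subseteq> {v, w}" "W \<inter> Nin = {}"
  | W w i where "W \<subseteq> V" "via (reorient A) W v u" "W \<inter> N \<subseteq> {v, w}" "W \<inter> Nin \<subseteq> {i}"
      "v \<notin> P" "link v w" "w \<in> P - Pout" "\<And>q. q \<in> W \<inter> Nout \<Longrightarrow> fwd q \<inter> Nin \<noteq> {}"
proof -
  have A: "A \<subseteq> N" "A \<inter> P = P - Pout" "P \<subseteq> Pout \<union> Pin"
      "\<And>v. v \<in> A - P \<Longrightarrow> \<exists>w. link v w \<and> (w \<notin> A \<or> w \<in> P - Pout)"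
    using assms(1,2) unfolding star_split_def by blast+
  have vV: "v \<in> V - {u}" using v N_V by auto
  have uN: "u \<notin> N" "u \<notin> Nin" "u \<notin> Nout" using N_V Nin_V Nout_V by auto
  consider "v \<notin> A" | "v \<in> Pin" | "v \<in> A" "v \<notin> Pin" by blast
  then show thesis
  proof cases
    case 1
    then show thesis using that(1)[of "{v, u}"] in_hub[of v A] v vV u_V uN by auto
  next
    case 2
    then have "fwd v \<inter> Nin \<noteq> {}" by (simp add: Pin_def)
    then obtain W i where W: "W \<subseteq> V - {u}" "i \<in> Nin" "via F W v i" "W \<inter> N \<subseteq> {v}"
      using path_to_Nin[of v] vV by metis
    have "via (reorient A) (W \<union> {i, u}) v u"
      using via_trans[OF via_F[OF W(3)] in_hub] W(2) by simp
    moreover have "W \<union> {i, u} \<subseteq> V" "(W \<union> {i, u}) \<inter> N \<subseteq> {v}"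
      using W Nin_N Nin_V u_V uN by auto
    ultimately show thesis using that(1)[of "W \<union> {i, u}"] by simp
  next
    case 3
    then have "v \<notin> P" using A by auto
    then obtain w where w: "link v w" "w \<notin> A \<or> w \<in> P - Pout" using A(4)[of v] 3 by blast
    obtain W where W: "W \<subseteq> V - {u}" "via F W v w" "W \<inter> N \<subseteq> {v, w}" "W - N \<subseteq> fwd v \<inter> bwd w"
      using link_path[OF w(1)] by metis
    have "fwd v \<inter> Nin = {}" using 3 v by (simp add: Pin_def)
    then have WNin: "W \<inter> Nin = {}" using W(4) Nin_N by blast
    have wV: "w \<in> N" "w \<in> V - {u}" using w(1) N_V by (auto simp: link_def)
    show thesis
    proof (cases "w \<in> A")
      case False
      have "via (reorient A) (W \<union> {w, u}) v u"
        using via_trans[OF via_F[OF W(2)] in_hub] False wV by simp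
      moreover have "W \<union> {w, u} \<subseteq> V" "(W \<union> {w, u}) \<inter> N \<subseteq> {v, w}" "(W \<union> {w, u}) \<inter> Nin = {}"
        using W WNin wV u_V uN Nin_N by auto
      ultimately show thesis using that(2)[of "W \<union> {w, u}" w] by simp
    next
      case True
      then have wP: "w \<in> P - Pout" using w(2) by blast
      then have "fwd w \<inter> Nin \<noteq> {}" using A(3) by (auto simp: Pin_def)
      then obtain W' i where W': "W' \<subseteq> V - {u}" "i \<in> Nin" "via F W' w i" "W' \<inter> N \<subseteq> {w}"
        "W' \<inter> Nin \<subseteq> {i}" "\<And>q. q \<in> W' \<Longrightarrow> i \<in> fwd q"
        using path_to_Nin[of w] wV(2) by metis
      let ?W = "W \<union> W' \<union> {i, u}"
      have "via (reorient A) ?W v u"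
        using via_trans[OF via_trans[OF via_F[OF W(2)] via_F[OF W'(3)]] in_hub] W'(2) by simp
      moreover have "?W \<subseteq> V" using W(1) W'(1) Nin_V W'(2) u_V by auto
      moreover have "?W \<inter> N \<subseteq> {v, w}" using W(3) W'(2,4) Nin_N uN by auto
      moreover have "?W \<inter> Nin \<subseteq> {i}" using WNin W'(5) uN by auto
      moreover have "fwd q \<inter> Nin \<noteq> {}" if "q \<in> ?W \<inter> Nout" for q
      proof -
        \<comment> \<open>Since \<open>w\<close> is not in \<open>Pout\<close>, no vertex of
          \<open>Nout\<close> lies on the link; one on the route therefore lies on the second part,
          from which \<open>i\<close> is reached.\<close>
        have "bwd w \<inter> Nout = {}" using wP wV by (auto simp: Pout_def)
        then have "q \<notin> W" using that W(4) Nout_N by blast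
        then have "q \<in> W' \<or> q = i" using that uN by auto
        then have "i \<in> fwd q" using W'(6) fwd_self by blast
        then show ?thesis using W'(2) by blast
      qed
      ultimately show thesis using that(3)[of ?W w i] \<open>v \<notin> P\<close> w(1) wP by simp
    qed
  qed
qed

lemma to_hub:
  assumes A: "star_split P A" "P \<subseteq> Pout \<union> Pin" "Pout \<subseteq> P"
    and x: "x \<in> V"
  obtains W v where "W \<subseteq> V" "via (reorient A) W x u" "W \<inter> N \<subseteq> {v}"
  | W v w where "W \<subseteq> V" "via (reorient A) W x u" "W \<inter> N \<subseteq> {v, w}" "W \<inter> Nin = {}"
  | W v w i where "W \<subseteq> V" "via (reorient A) W x u" "W \<inter> N \<subseteq> {v, w}" "W \<inter> Nin \<subseteq> {i}"
      "link v w" "w \<in> P - Pout" "\<And>q. q \<in> W \<inter> Nout \<Longrightarrow> fwd q \<inter> Nin \<noteq> {}"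
  using first_N[OF x, of A]
proof (elim disjE exE conjE bexE)
  fix W assume "W \<subseteq> V" "via (reorient A) W x u" "W \<inter> N = {}"
  then show thesis using that(1)[of W undefined] by simp
next
  fix z W
  assume z: "z \<in> N" and W: "W \<subseteq> V" "via F W x z" "W \<inter> N \<subseteq> {z}" "W \<inter> Nin = {}" "W \<inter> Nout \<subseteq> bwd z"
  show thesis
    using A(1,2) z
  proof (rule N_to_hub)
    fix W' assume W': "W' \<subseteq> V" "via (reorient A) W' z u" "W' \<inter> N \<subseteq> {z}"
    show thesis
    proof (rule that(1))
      show "via (reorient A) (W \<union> W') x u" using via_trans[OF via_F[OF W(2)] W'(2)] .
    qed (use W W' in auto)
  next
    fix W' w assume W': "W' \<subseteq> V" "via (reorient A) W' z u" "W' \<inter> N \<subseteq> {z, w}" "W' \<inter> Nin = {}"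
    show thesis
    proof (rule that(2))
      show "via (reorient A) (W \<union> W') x u" using via_trans[OF via_F[OF W(2)] W'(2)] .
      show "(W \<union> W') \<inter> N \<subseteq> {z, w}" using W W' by auto
    qed (use W W' in auto)
  next
    fix W' w i assume W': "W' \<subseteq> V" "via (reorient A) W' z u" "W' \<inter> N \<subseteq> {z, w}" "W' \<inter> Nin \<subseteq> {i}"
      "z \<notin> P" "link z w" "w \<in> P - Pout" "\<And>q. q \<in> W' \<inter> Nout \<Longrightarrow> fwd q \<inter> Nin \<noteq> {}"
    \<comment> \<open>In this outcome \<open>z\<close> is outside \<open>Pout\<close>, so the
      initial segment contributes no vertex of \<open>Nout\<close>.\<close>
    have "bwd z \<inter> Nout = {}" using W'(5) A(3) z by (auto simp: Pout_def)
    then have WNout: "W \<inter> Nout = {}" using W(5) by blast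
    show thesis
    proof (rule that(3))
      show "via (reorient A) (W \<union> W') x u" using via_trans[OF via_F[OF W(2)] W'(2)] .
      show "(W \<union> W') \<inter> N \<subseteq> {z, w}" "(W \<union> W') \<inter> Nin \<subseteq> {i}" "W \<union> W' \<subseteq> V" using W W' by auto
      show "fwd q \<inter> Nin \<noteq> {}" if "q \<in> (W \<union> W') \<inter> Nout" for q
        using that WNout W'(8)[of q] by blast
    qed (fact W'(6,7))+
  qed
qed

text \<open>Three vertices of \<open>N\<close> are needed only if the route enters \<open>a\<close>
  and follows two links through \<open>c\<close>. As none of \<open>a\<close>, \<open>c\<close>,
  \<open>v\<close> then lies in \<open>P\<close>, which contains \<open>Pout\<close>, the route
  misses \<open>Nout\<close>, and by \<open>H\<close> also \<open>Nin\<close>.\<close>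

lemma N_from_hub:
  assumes "star_split P A" "Pout \<subseteq> P"
    and H: "Pin \<subseteq> P \<or> (\<forall>q\<in>Nin. bwd q \<inter> Nout \<noteq> {})"
    and v: "v \<in> N"
  obtains W z where "W \<subseteq> V" "via (reorient A) W u v" "W \<inter> N \<subseteq> {z, v}"
  | W a c where "W \<subseteq> V" "via (reorient A) W u v" "W \<inter> N \<subseteq> {a, c, v}" "W \<inter> Nin = {}" "W \<inter> Nout = {}"
      "link a c" "link c v" "v \<notin> P"
proof -
  have A: "A \<subseteq> N" "Pout \<subseteq> P"
      "\<And>v. v \<in> N - A \<Longrightarrow> v \<in> Pout \<or> (\<exists>z. link z v \<and> (z \<in> A \<or> z \<in> Pout)) \<or>
        (\<exists>a c. link a c \<and> link c v \<and> a \<in> A \<and> {a, c, v} \<inter> P = {})"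
    using assms(1,2) unfolding star_split_def by blast+
  have vV: "v \<in> V - {u}" using v N_V by auto
  have uN: "u \<notin> N" "u \<notin> Nin" "u \<notin> Nout" using N_V Nin_V Nout_V by auto
  have Pout_path: "\<exists>W\<subseteq>V. via (reorient A) W u p \<and> W \<inter> N \<subseteq> {p}" if "p \<in> Pout" for p
  proof -
    have p: "bwd p \<inter> Nout \<noteq> {}" "p \<in> V - {u}" using that N_V by (auto simp: Pout_def)
    then obtain W q where W: "W \<subseteq> V - {u}" "q \<in> Nout" "via F W q p" "W \<inter> N \<subseteq> {p}"
      using path_from_Nout by metis
    have "via (reorient A) ({u, q} \<union> W) u p"
      using via_trans[OF out_hub via_F[OF W(3)]] W(2) by simp
    moreover have "{u, q} \<union> W \<subseteq> V" "({u, q} \<union> W) \<inter> N \<subseteq> {p}"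
      using W Nout_V Nout_N u_V uN by auto
    ultimately show ?thesis by blast
  qed
  consider "v \<in> A" | "v \<in> Pout" | z where "link z v" "z \<in> A \<or> z \<in> Pout" |
    a c where "link a c" "link c v" "a \<in> A" "{a, c, v} \<inter> P = {}"
  proof (cases "v \<in> A")
    case False
    then show ?thesis using A(3)[of v] v that(2-4) by auto
  qed (rule that(1))
  then show thesis
  proof cases
    case 1
    then show thesis using that(1)[of "{u, v}" v] out_hub[of v A] vV u_V uN by auto
  next
    case 2
    then obtain W where "W \<subseteq> V" "via (reorient A) W u v" "W \<inter> N \<subseteq> {v}"
      using Pout_path by blast
    then show thesis using that(1)[of W v] by simp
  next
    case (3 z)
    obtain W where W: "W \<subseteq> V - {u}" "via F W z v" "W \<inter> N \<subseteq> {z, v}"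
      using link_path[OF 3(1)] by metis
    have zV: "z \<in> V - {u}" using 3(1) N_V by (auto simp: link_def)
    have "\<exists>W\<subseteq>V. via (reorient A) W u z \<and> W \<inter> N \<subseteq> {z}"
      using 3(2)
    proof
      assume "z \<in> A"
      then show ?thesis using out_hub[of z A] zV u_V uN by (intro exI[of _ "{u, z}"]) auto
    qed (rule Pout_path)
    then obtain W' where W': "W' \<subseteq> V" "via (reorient A) W' u z" "W' \<inter> N \<subseteq> {z}" by blast
    have "via (reorient A) (W' \<union> W) u v" using via_trans[OF W'(2) via_F[OF W(2)]] .
    moreover have "W' \<union> W \<subseteq> V" "(W' \<union> W) \<inter> N \<subseteq> {z, v}" using W W' by auto
    ultimately show thesis using that(1)[of "W' \<union> W" z] by simp
  next
    case (4 a c)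
    obtain W1 where W1: "W1 \<subseteq> V - {u}" "via F W1 a c" "W1 \<inter> N \<subseteq> {a, c}" "W1 - N \<subseteq> fwd a \<inter> bwd c"
      using link_path[OF 4(1)] by metis
    obtain W2 where W2: "W2 \<subseteq> V - {u}" "via F W2 c v" "W2 \<inter> N \<subseteq> {c, v}" "W2 - N \<subseteq> fwd c \<inter> bwd v"
      using link_path[OF 4(2)] by metis
    have acN: "a \<in> N" "c \<in> N" using 4(1) by (auto simp: link_def)
    have out0: "bwd c \<inter> Nout = {}" "bwd v \<inter> Nout = {}"
      using 4(4) A(2) acN v by (auto simp: Pout_def)
    have "W1 \<inter> Nout = {}" "W2 \<inter> Nout = {}"
      using W1(4) W2(4) out0 Nout_N by blast+
    moreover have "W1 \<inter> Nin = {} \<and> W2 \<inter> Nin = {}"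
      using H
    proof
      assume "Pin \<subseteq> P"
      then have "fwd a \<inter> Nin = {}" "fwd c \<inter> Nin = {}"
        using 4(4) acN by (auto simp: Pin_def)
      then show ?thesis using W1(4) W2(4) Nin_N by blast
    next
      assume H: "\<forall>q\<in>Nin. bwd q \<inter> Nout \<noteq> {}"
      \<comment> \<open>A vertex of \<open>Nin\<close> in front of \<open>c\<close> or
        \<open>v\<close> would bring some vertex of \<open>Nout\<close> in front of it as
        well.\<close>
      have "q \<notin> bwd c" "q \<notin> bwd v" if "q \<in> Nin" for q
        using H that out0 bwd_trans by blast+
      then show ?thesis using W1(4) W2(4) Nin_N by blast
    qed
    moreover have "via (reorient A) ({u, a} \<union> W1 \<union> W2) u v"
      using via_trans[OF via_trans[OF out_hub via_F[OF W1(2)]] via_F[OF W2(2)]] 4(3) by simp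
    moreover have "{u, a} \<union> W1 \<union> W2 \<subseteq> V" "({u, a} \<union> W1 \<union> W2) \<inter> N \<subseteq> {a, c, v}"
      using W1 W2 u_V uN acN N_V by auto
    moreover have "a \<notin> Nin" "a \<notin> Nout" using acN Nin_N Nout_N by auto
    moreover have "v \<notin> P" using 4(4) by simp
    ultimately show thesis using that(2)[of "{u, a} \<union> W1 \<union> W2" a c] 4(1,2) uN by (auto simp: Int_Un_distrib2)
  qed
qed

lemma from_hub:
  assumes A: "star_split P A" "Pout \<subseteq> P"
    and H: "Pin \<subseteq> P \<or> (\<forall>q\<in>Nin. bwd q \<inter> Nout \<noteq> {})"
    and y: "y \<in> V"
  obtains W z v where "W \<subseteq> V" "via (reorient A) W u y" "W \<inter> N \<subseteq> {z, v}"
  | W a c v where "W \<subseteq> V" "via (reorient A) W u y" "W \<inter> N \<subseteq> {a, c, v}" "W \<inter> Nin = {}" "W \<inter> Nout = {}"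
      "link a c" "link c v"
  using last_N[OF y star_split_subset[OF A(1)]]
proof (elim disjE exE conjE bexE)
  fix W assume "W \<subseteq> V" "via (reorient A) W u y" "W \<inter> N = {}"
  then show thesis using that(1)[of W] by simp
next
  fix z W
  assume z: "z \<in> N" and W: "W \<subseteq> V" "via F W z y" "W \<inter> N \<subseteq> {z}" "W \<inter> Nout = {}" "W \<inter> Nin \<subseteq> fwd z"
    "\<forall>q\<in>W \<inter> Nin. bwd q \<inter> Nout = {}"
  show thesis
    using A H z
  proof (rule N_from_hub)
    fix W' z' assume W': "W' \<subseteq> V" "via (reorient A) W' u z" "W' \<inter> N \<subseteq> {z', z}"
    show thesis
    proof (rule that(1))
      show "via (reorient A) (W' \<union> W) u y" using via_trans[OF W'(2) via_F[OF W(2)]] .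
      show "(W' \<union> W) \<inter> N \<subseteq> {z', z}" using W W' by auto
    qed (use W W' in auto)
  next
    fix W' a c assume W': "W' \<subseteq> V" "via (reorient A) W' u z" "W' \<inter> N \<subseteq> {a, c, z}" "W' \<inter> Nin = {}"
      "W' \<inter> Nout = {}" "link a c" "link c z" "z \<notin> P"
    have "W \<inter> Nin = {}"
      using H
    proof
      assume "Pin \<subseteq> P"
      then have "fwd z \<inter> Nin = {}" using W'(8) z by (auto simp: Pin_def)
      then show ?thesis using W(5) by blast
    qed (use W(6) in blast)
    show thesis
    proof (rule that(2))
      show "via (reorient A) (W' \<union> W) u y" using via_trans[OF W'(2) via_F[OF W(2)]] .
      show "(W' \<union> W) \<inter> N \<subseteq> {a, c, z}" "(W' \<union> W) \<inter> Nin = {}" "(W' \<union> W) \<inter> Nout = {}" "W' \<union> W \<subseteq> V"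
        using W W' \<open>W \<inter> Nin = {}\<close> by auto
    qed (fact W'(6,7))+
  qed
qed

section \<open>Counting vertices on routes\<close>

text \<open>Stated additively: the distances are less than \<open>card V - card N + k\<close>.\<close>
definition linked_within :: "'a set \<Rightarrow> nat \<Rightarrow> bool" where
  "linked_within A k \<longleftrightarrow> (\<forall>x\<in>V. \<forall>y\<in>V. \<exists>W\<subseteq>V. via (reorient A) W x y \<and> card W + card N \<le> card V + k)"

text \<open>Inclusion-exclusion for \<open>W\<close> and \<open>N\<close> inside \<open>V\<close>:
  the saving is the part of \<open>N\<close> outside \<open>W\<close>.\<close>

lemma card_meet_N:
  assumes "W \<subseteq> V"
  shows "card W + card N \<le> card V + card (W \<inter> N)"
proof -
  have "finite W" using assms finite_V finite_subset by blast
  then have "card (W \<union> N) + card (W \<inter> N) = card W + card N"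
    using card_Un_Int finite_N by metis
  moreover have "card (W \<union> N) \<le> card V"
    using assms N_V finite_V by (intro card_mono) auto
  ultimately show ?thesis by simp
qed

text \<open>A missed fixed neighbour of \<open>u\<close> can be added to \<open>W\<close> without
  meeting \<open>N\<close> further, so it compensates for one vertex of \<open>N\<close>.\<close>

lemma card_meet_N_miss:
  assumes "W \<subseteq> V" "m \<in> Nin \<union> Nout" "m \<notin> W"
  shows "card W + card N < card V + card (W \<inter> N)"
proof -
  have m: "m \<notin> N" "m \<in> V" using assms(2) Nin_N Nout_N Nin_V Nout_V by auto
  have "card (insert m W) + card N \<le> card V + card (insert m W \<inter> N)"
    using assms m by (intro card_meet_N) auto
  moreover have "finite W" using assms finite_V finite_subset by blast
  ultimately show ?thesis using assms m by simp
qed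

lemma dual_linked_within:
  assumes "hub.linked_within V (T\<inverse>) u N A k" "A \<subseteq> N"
  shows "linked_within (N - A) k"
  using assms(1) unfolding hub.linked_within_def[OF hub_converse] linked_within_def
  by (simp add: dual_reorient[OF assms(2)] via_converse)

text \<open>The half of the route to \<open>u\<close> has at most two vertices in \<open>N\<close>
  and the half from \<open>u\<close> at most three. Only two plus three exceeds four, and then the
  information on \<open>Nin\<close> and \<open>Nout\<close> is kept in order to find a missed
  neighbour, or to identify the five vertices.\<close>

lemma assigned_path:
  assumes A: "star_split P A"
    and P: "Pout \<subseteq> P" "P \<subseteq> Pout \<union> Pin"
    and H: "Pin \<subseteq> P \<or> (\<forall>q\<in>Nin. bwd q \<inter> Nout \<noteq> {})"
    and x: "x \<in> V" and y: "y \<in> V"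
  obtains W where "W \<subseteq> V" "via (reorient A) W x y" "card (W \<inter> N) \<le> 4"
  | W where "W \<subseteq> V" "via (reorient A) W x y" "card (W \<inter> N) \<le> 5" "W \<inter> Nin = {}"
  | W v w a c b i where "W \<subseteq> V" "via (reorient A) W x y" "W \<inter> N \<subseteq> {v, w, a, c, b}"
      "card (W \<inter> N) \<le> 5" "W \<inter> Nin \<subseteq> {i}" "\<And>q. q \<in> W \<inter> Nout \<Longrightarrow> fwd q \<inter> Nin \<noteq> {}"
      "link v w" "w \<in> P - Pout" "link a c" "link c b"
proof -
  have card: "card S \<le> card S'" if "S \<subseteq> S'" "finite S'" for S S' :: "'a set"
    using that by (rule card_mono[rotated])
  show thesis
    using A P(2,1) x
  proof (rule to_hub)
    fix W v assume W: "W \<subseteq> V" "via (reorient A) W x u" "W \<inter> N \<subseteq> {v}"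
    show thesis
      using A P(1) H y
    proof (rule from_hub)
      fix W' z v' assume W': "W' \<subseteq> V" "via (reorient A) W' u y" "W' \<inter> N \<subseteq> {z, v'}"
      have "card ((W \<union> W') \<inter> N) \<le> card {v, z, v'}"
        using W(3) W'(3) by (intro card) auto
      then show thesis
        using that(1)[of "W \<union> W'"] W W' via_trans[OF W(2) W'(2)] by (simp add: card_insert_if split: if_splits)
    next
      fix W' a c v' assume W': "W' \<subseteq> V" "via (reorient A) W' u y" "W' \<inter> N \<subseteq> {a, c, v'}"
      have "card ((W \<union> W') \<inter> N) \<le> card {v, a, c, v'}"
        using W(3) W'(3) by (intro card) auto
      then show thesis
        using that(1)[of "W \<union> W'"] W W' via_trans[OF W(2) W'(2)] by (simp add: card_insert_if split: if_splits)
    qed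
  next
    fix W v w assume W: "W \<subseteq> V" "via (reorient A) W x u" "W \<inter> N \<subseteq> {v, w}" "W \<inter> Nin = {}"
    show thesis
      using A P(1) H y
    proof (rule from_hub)
      fix W' z v' assume W': "W' \<subseteq> V" "via (reorient A) W' u y" "W' \<inter> N \<subseteq> {z, v'}"
      have "card ((W \<union> W') \<inter> N) \<le> card {v, w, z, v'}"
        using W(3) W'(3) by (intro card) auto
      then show thesis
        using that(1)[of "W \<union> W'"] W W' via_trans[OF W(2) W'(2)] by (simp add: card_insert_if split: if_splits)
    next
      fix W' a c v' assume W': "W' \<subseteq> V" "via (reorient A) W' u y" "W' \<inter> N \<subseteq> {a, c, v'}" "W' \<inter> Nin = {}"
      have "card ((W \<union> W') \<inter> N) \<le> card {v, w, a, c, v'}"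
        using W(3) W'(3) by (intro card) auto
      moreover have "(W \<union> W') \<inter> Nin = {}" using W(4) W'(4) by auto
      ultimately show thesis
        using that(2)[of "W \<union> W'"] W W' via_trans[OF W(2) W'(2)] by (simp add: card_insert_if split: if_splits)
    qed
  next
    fix W v w i assume W: "W \<subseteq> V" "via (reorient A) W x u" "W \<inter> N \<subseteq> {v, w}" "W \<inter> Nin \<subseteq> {i}"
      "link v w" "w \<in> P - Pout" "\<And>q. q \<in> W \<inter> Nout \<Longrightarrow> fwd q \<inter> Nin \<noteq> {}"
    show thesis
      using A P(1) H y
    proof (rule from_hub)
      fix W' z v' assume W': "W' \<subseteq> V" "via (reorient A) W' u y" "W' \<inter> N \<subseteq> {z, v'}"
      have "card ((W \<union> W') \<inter> N) \<le> card {v, w, z, v'}"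
        using W(3) W'(3) by (intro card) auto
      then show thesis
        using that(1)[of "W \<union> W'"] W W' via_trans[OF W(2) W'(2)] by (simp add: card_insert_if split: if_splits)
    next
      fix W' a c v' assume W': "W' \<subseteq> V" "via (reorient A) W' u y" "W' \<inter> N \<subseteq> {a, c, v'}" "W' \<inter> Nin = {}"
        "W' \<inter> Nout = {}" "link a c" "link c v'"
      have "card ((W \<union> W') \<inter> N) \<le> card {v, w, a, c, v'}"
        using W(3) W'(3) by (intro card) auto
      then have c5: "card ((W \<union> W') \<inter> N) \<le> 5" by (simp add: card_insert_if split: if_splits)
      show thesis
      proof (rule that(3))
        show "(W \<union> W') \<inter> N \<subseteq> {v, w, a, c, v'}" "(W \<union> W') \<inter> Nin \<subseteq> {i}" "W \<union> W' \<subseteq> V"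
          using W W' by auto
        show "via (reorient A) (W \<union> W') x y" using via_trans[OF W(2) W'(2)] .
        show "fwd q \<inter> Nin \<noteq> {}" if "q \<in> (W \<union> W') \<inter> Nout" for q
          using that W'(5) W(7)[of q] by blast
      qed (fact c5 W(5,6) W'(6,7))+
    qed
  qed
qed

lemma ex_full_star_split: "\<exists>A. star_split (Pout \<union> Pin) A"
  using linked by (intro ex_star_split) auto

text \<open>With \<open>P = Pout \<union> Pin\<close> the first alternative of \<open>H\<close> in
  \<open>assigned_path\<close> holds, and every outcome has at most five vertices in
  \<open>N\<close>.\<close>

lemma linked_within_5: "\<exists>A\<subseteq>N. linked_within A 5"
proof -
  obtain A where A: "star_split (Pout \<union> Pin) A" using ex_full_star_split by blast
  have "\<exists>W\<subseteq>V. via (reorient A) W x y \<and> card W + card N \<le> card V + 5"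
    if xy: "x \<in> V" "y \<in> V" for x y
  proof -
    have short: ?thesis if "W \<subseteq> V" "via (reorient A) W x y" "card (W \<inter> N) \<le> 5" for W
      using that card_meet_N[of W] by (intro exI[of _ W]) simp
    show ?thesis
      by (rule assigned_path[OF A _ _ _ xy]) (use short in auto)
  qed
  then show ?thesis using star_split_subset[OF A] unfolding linked_within_def by blast
qed

text \<open>A route with five vertices in \<open>N\<close> meets \<open>Nin\<close> in at most one
  vertex, so it misses another one there.\<close>

lemma linked_within_4_if_two_in:
  assumes "card Nin \<ge> 2"
  shows "\<exists>A\<subseteq>N. linked_within A 4"
proof -
  obtain A where A: "star_split (Pout \<union> Pin) A" using ex_full_star_split by blast
  have miss: "\<exists>m\<in>Nin. m \<notin> W" if "W \<inter> Nin \<subseteq> {i}" for W i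
  proof (rule ccontr)
    assume "\<not> ?thesis"
    then have "Nin \<subseteq> {i}" using that by blast
    then have "card Nin \<le> 1" using card_mono[of "{i}" Nin] by simp
    then show False using assms by simp
  qed
  have "\<exists>W\<subseteq>V. via (reorient A) W x y \<and> card W + card N \<le> card V + 4"
    if xy: "x \<in> V" "y \<in> V" for x y
  proof -
    have short: ?thesis
      if W: "W \<subseteq> V" "via (reorient A) W x y" "card (W \<inter> N) \<le> 5" "W \<inter> Nin \<subseteq> {i}" for W i
    proof -
      obtain m where "m \<in> Nin \<union> Nout" "m \<notin> W" using miss[OF W(4)] by blast
      then show ?thesis using card_meet_N_miss[of W m] W by (intro exI[of _ W]) simp
    qed
    have short4: ?thesis if "W \<subseteq> V" "via (reorient A) W x y" "card (W \<inter> N) \<le> 4" for W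
      using that card_meet_N[of W] by (intro exI[of _ W]) simp
    show ?thesis
      by (rule assigned_path[OF A _ _ _ xy]) (use short short4 in auto)
  qed
  then show ?thesis using star_split_subset[OF A] unfolding linked_within_def by blast
qed

text \<open>If the out-neighbour reaches the in-neighbour without meeting \<open>N\<close>, then whatever the
  in-neighbour reaches is in \<open>Pout\<close> already, and the vertices of \<open>Pin\<close> can be treated like all others.\<close>
lemma linked_within_4_if_in_and_out:
  assumes "Nin = {i}" "Nout = {o'}"
  shows "\<exists>A\<subseteq>N. linked_within A 4"
proof -
  \<comment> \<open>If \<open>i\<close> is reached from \<open>o'\<close> outside \<open>N\<close>,
    only vertices without any link are added to \<open>Pout\<close>, as links cannot cover them. No
    link then ends in \<open>P - Pout\<close>.\<close>
  define P where "P = (if i \<in> fwd o' then Pout \<union> {v \<in> N. \<forall>w. \<not> link v w \<and> \<not> link w v} else Pout \<union> Pin)"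
  have P: "Pout \<subseteq> P" "P \<subseteq> Pout \<union> Pin" using linked by (auto simp: P_def)
  have "\<exists>w. link v w \<or> link w v" if "v \<in> N - P" for v
    using that linked by (auto simp: P_def split: if_splits)
  then obtain A where A: "star_split P A" using ex_star_split[OF P] by blast
  have "o' \<notin> N" using assms Nout_N by auto
  then have H: "Pin \<subseteq> P \<or> (\<forall>q\<in>Nin. bwd q \<inter> Nout \<noteq> {})"
    using fwd_imp_bwd[of i o'] assms by (auto simp: P_def)
  have "\<exists>W\<subseteq>V. via (reorient A) W x y \<and> card W + card N \<le> card V + 4"
    if xy: "x \<in> V" "y \<in> V" for x y
  proof -
    have short: ?thesis
      if W: "W \<subseteq> V" "via (reorient A) W x y" "card (W \<inter> N) \<le> 5" "m \<in> Nin \<union> Nout" "m \<notin> W" for W m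
      using card_meet_N_miss[of W m] W by (intro exI[of _ W]) simp
    show ?thesis
    proof (rule assigned_path[OF A P H xy])
      show ?thesis if "W \<subseteq> V" "via (reorient A) W x y" "card (W \<inter> N) \<le> 4" for W
        using that card_meet_N[of W] by (intro exI[of _ W]) simp
    next
      show ?thesis if "W \<subseteq> V" "via (reorient A) W x y" "card (W \<inter> N) \<le> 5" "W \<inter> Nin = {}" for W
        using that short[of W i] assms by auto
    next
      fix W v w a c b j
      assume W: "W \<subseteq> V" "via (reorient A) W x y" "card (W \<inter> N) \<le> 5" "link v w" "w \<in> P - Pout"
        and q: "\<And>q. q \<in> W \<inter> Nout \<Longrightarrow> fwd q \<inter> Nin \<noteq> {}"
      \<comment> \<open>The link ending in \<open>P - Pout\<close> excludes the first choice of
        \<open>P\<close>, so \<open>o'\<close> does not lead to \<open>i\<close> outside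
        \<open>N\<close>, and \<open>o'\<close> is the missed vertex.\<close>
      have "i \<notin> fwd o'" using W(4,5) by (auto simp: P_def)
      then have "o' \<notin> W" using q[of o'] assms by auto
      then show ?thesis using short[of W o'] W assms by auto
    qed
  qed
  then show ?thesis using star_split_subset[OF A] unfolding linked_within_def by blast
qed

text \<open>The only obstruction in degree five: reversing the edge at the star centre \<open>c\<close> makes \<open>b\<close>
  the only vertex of \<open>N\<close> that is not entered directly from \<open>u\<close>.\<close>
lemma linked_within_4_if_five_linked:
  assumes N: "N = {v, w, a, c, b}" "card N = 5" and "link v w" "w \<in> Pin" "link a c" "link c b"
  shows "linked_within (N - {b}) 4"
proof -
  let ?A = "N - {b}"
  have dist: "v \<noteq> b" "w \<noteq> b" "a \<noteq> b" "c \<noteq> b"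
    using N by (auto simp: card_insert_if split: if_splits)
  have uN: "u \<notin> N" "u \<notin> Nin" "u \<notin> Nout" using N_V Nin_V Nout_V by auto
  have NV: "v \<in> V" "w \<in> V" "a \<in> V" "c \<in> V" "b \<in> V" using N N_V by auto
  have b: "via (reorient ?A) {b, u} b u" using N by (intro in_hub) auto
  obtain Wc where Wc: "Wc \<subseteq> V - {u}" "via F Wc c b" "Wc \<inter> N \<subseteq> {c, b}"
    using link_path[OF assms(6)] by metis
  obtain Wa where Wa: "Wa \<subseteq> V - {u}" "via F Wa a c" "Wa \<inter> N \<subseteq> {a, c}"
    using link_path[OF assms(5)] by metis
  obtain Wv where Wv: "Wv \<subseteq> V - {u}" "via F Wv v w" "Wv \<inter> N \<subseteq> {v, w}"
    using link_path[OF assms(3)] by metis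
  have "fwd w \<inter> Nin \<noteq> {}" "w \<in> V - {u}" using assms(4) N_V by (auto simp: Pin_def)
  then obtain Ww i where Ww: "Ww \<subseteq> V - {u}" "i \<in> Nin" "via F Ww w i" "Ww \<inter> N \<subseteq> {w}"
    using path_to_Nin[of w] by metis
  have w: "via (reorient ?A) (Ww \<union> {i, u}) w u"
    using via_trans[OF via_F[OF Ww(3)] in_hub] Ww(2) by simp
  have i: "i \<in> V" "i \<notin> N" using Ww(2) Nin_V Nin_N by auto
  have c: "via (reorient ?A) (Wc \<union> {b, u}) c u"
    using via_trans[OF via_F[OF Wc(2)] b] .
  \<comment> \<open>The exits: \<open>b\<close> uses its own edge, \<open>c\<close> and
    \<open>a\<close> proceed to \<open>b\<close>, \<open>w\<close> has a fixed exit, and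
    \<open>v\<close> proceeds to \<open>w\<close>.\<close>
  have to_u: "\<exists>W\<subseteq>V. via (reorient ?A) W z u \<and> (W \<inter> N \<subseteq> {a, c, b} \<or> W \<inter> N \<subseteq> {v, w})"
    if "z \<in> N" for z
  proof -
    consider "z = v" | "z = w" | "z = a" | "z = c" | "z = b" using \<open>z \<in> N\<close> N(1) by auto
    then show ?thesis
    proof cases
      case 1
      then show ?thesis using via_trans[OF via_F[OF Wv(2)] w] Wv Ww uN u_V i
        by (intro exI[of _ "Wv \<union> (Ww \<union> {i, u})"]) auto
    next
      case 2
      then show ?thesis using w Ww uN u_V i
        by (intro exI[of _ "Ww \<union> {i, u}"]) auto
    next
      case 3
      then show ?thesis using via_trans[OF via_F[OF Wa(2)] c] Wa Wc uN u_V NV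
        by (intro exI[of _ "Wa \<union> (Wc \<union> {b, u})"]) auto
    next
      case 4
      then show ?thesis using c Wc uN u_V NV
        by (intro exI[of _ "Wc \<union> {b, u}"]) auto
    next
      case 5
      then show ?thesis using b uN u_V NV by (intro exI[of _ "{b, u}"]) auto
    qed
  qed
  have from_u: "\<exists>W\<subseteq>V. via (reorient ?A) W u z \<and> (W \<inter> N \<subseteq> {z} \<or> W \<inter> N \<subseteq> {c, b})"
    if "z \<in> N" for z
  proof (cases "z = b")
    case True
    have "via (reorient ?A) ({u, c} \<union> Wc) u b"
      using via_trans[OF out_hub via_F[OF Wc(2)]] N dist by simp
    then show ?thesis using True Wc uN u_V NV by (intro exI[of _ "{u, c} \<union> Wc"]) auto
  next
    case False
    then show ?thesis using that out_hub[of z ?A] N_V uN u_V by (intro exI[of _ "{u, z}"]) auto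
  qed
  have to_x: "\<exists>W\<subseteq>V. via (reorient ?A) W x u \<and> (W \<inter> N \<subseteq> {a, c, b} \<or> W \<inter> N \<subseteq> {v, w})"
    if "x \<in> V" for x
    using first_N[OF that, of ?A]
  proof (elim disjE exE conjE bexE)
    fix z W assume z: "z \<in> N" and W: "W \<subseteq> V" "via F W x z" "W \<inter> N \<subseteq> {z}"
    obtain W' where W': "W' \<subseteq> V" "via (reorient ?A) W' z u" "W' \<inter> N \<subseteq> {a, c, b} \<or> W' \<inter> N \<subseteq> {v, w}"
      using to_u[OF z] by blast
    have "z \<in> W'" using W'(2) by (simp add: via_def)
    then have "(W \<union> W') \<inter> N = W' \<inter> N" using W(3) z by auto
    then show ?thesis using via_trans[OF via_F[OF W(2)] W'(2)] W W'
      by (intro exI[of _ "W \<union> W'"]) auto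
  qed auto
  have from_y: "\<exists>W\<subseteq>V. \<exists>z. via (reorient ?A) W u y \<and> (W \<inter> N \<subseteq> {z} \<or> W \<inter> N \<subseteq> {c, b})"
    if "y \<in> V" for y
    using last_N[OF that Diff_subset[of N "{b}"]]
  proof (elim disjE exE conjE bexE)
    fix z W assume z: "z \<in> N" and W: "W \<subseteq> V" "via F W z y" "W \<inter> N \<subseteq> {z}"
    obtain W' where W': "W' \<subseteq> V" "via (reorient ?A) W' u z" "W' \<inter> N \<subseteq> {z} \<or> W' \<inter> N \<subseteq> {c, b}"
      using from_u[OF z] by blast
    have "z \<in> W'" using W'(2) by (simp add: via_def)
    then have "(W' \<union> W) \<inter> N = W' \<inter> N" using W(3) z by auto
    then show ?thesis using via_trans[OF W'(2) via_F[OF W(2)]] W W'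
      by (intro exI[of _ "W' \<union> W"]) auto
  qed auto
  show ?thesis
    unfolding linked_within_def
  proof (intro ballI)
    fix x y assume xy: "x \<in> V" "y \<in> V"
    obtain W where W: "W \<subseteq> V" "via (reorient ?A) W x u" "W \<inter> N \<subseteq> {a, c, b} \<or> W \<inter> N \<subseteq> {v, w}"
      using to_x[OF xy(1)] by blast
    obtain W' z where W': "W' \<subseteq> V" "via (reorient ?A) W' u y" "W' \<inter> N \<subseteq> {z} \<or> W' \<inter> N \<subseteq> {c, b}"
      using from_y[OF xy(2)] by blast
    \<comment> \<open>The only entrance with two vertices uses \<open>c\<close> and
      \<open>b\<close>, both on the only exit with three, so no union exceeds four.\<close>
    have "(W \<union> W') \<inter> N \<subseteq> {a, c, b, z} \<or> (W \<union> W') \<inter> N \<subseteq> {v, w, c, b} \<or> (W \<union> W') \<inter> N \<subseteq> {v, w, z}"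
      using W(3) W'(3) by auto
    then have "card ((W \<union> W') \<inter> N) \<le> 4"
    proof (elim disjE)
      show ?thesis if "(W \<union> W') \<inter> N \<subseteq> {a, c, b, z}"
        using card_mono[OF _ that] by (simp add: card_insert_if split: if_splits)
      show ?thesis if "(W \<union> W') \<inter> N \<subseteq> {v, w, c, b}"
        using card_mono[OF _ that] by (simp add: card_insert_if split: if_splits)
      show ?thesis if "(W \<union> W') \<inter> N \<subseteq> {v, w, z}"
        using card_mono[OF _ that] by (simp add: card_insert_if split: if_splits)
    qed
    then show "\<exists>W\<subseteq>V. via (reorient ?A) W x y \<and> card W + card N \<le> card V + 4"
      using via_trans[OF W(2) W'(2)] W W' card_meet_N[of "W \<union> W'"]
      by (intro exI[of _ "W \<union> W'"]) simp
  qed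
qed

text \<open>If the orientation from a star cover fails, the route found for the offending pair
  contains all five vertices of \<open>N\<close>. They are then the ends of the links recorded in
  \<open>assigned_path\<close>, and directing only the edge at \<open>b\<close> towards
  \<open>u\<close> repairs the bound.\<close>

lemma linked_within_4_if_one_in_degree_five:
  assumes "Nin = {i}" "card N = 5"
  shows "\<exists>A\<subseteq>N. linked_within A 4"
proof -
  obtain A where A: "star_split (Pout \<union> Pin) A" using ex_full_star_split by blast
  show ?thesis
  proof (cases "linked_within A 4")
    case True
    with star_split_subset[OF A] show ?thesis by blast
  next
    case False
    then obtain x y where xy: "x \<in> V" "y \<in> V"
      and far: "\<And>W. W \<subseteq> V \<Longrightarrow> via (reorient A) W x y \<Longrightarrow> card V + 4 < card W + card N"
      unfolding linked_within_def by (meson not_le)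
    show ?thesis
    proof (rule assigned_path[OF A _ _ _ xy])
      show ?thesis if "W \<subseteq> V" "via (reorient A) W x y" "card (W \<inter> N) \<le> 4" for W
        using far[of W] that card_meet_N[of W] by simp
    next
      show ?thesis if "W \<subseteq> V" "via (reorient A) W x y" "card (W \<inter> N) \<le> 5" "W \<inter> Nin = {}" for W
        using far[of W] that card_meet_N_miss[of W i] assms by auto
    next
      fix W v w a c b
      assume W: "W \<subseteq> V" "via (reorient A) W x y" "W \<inter> N \<subseteq> {v, w, a, c, b}" "link v w"
        "w \<in> Pout \<union> Pin - Pout" "link a c" "link c b"
      have "card N \<le> card (W \<inter> N)" using far[of W] W card_meet_N[of W] assms by simp
      then have "W \<inter> N = N" using finite_N by (intro card_seteq) auto
      then have "N = {v, w, a, c, b}" using W(3,4,6,7) by (auto simp: link_def)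
      then have "linked_within (N - {b}) 4"
        using W assms(2) by (intro linked_within_4_if_five_linked) auto
      then show ?thesis by blast
    qed auto
  qed
qed

text \<open>Cases that rest on outgoing arcs are reduced to incoming ones by reversing all
  arcs.\<close>

lemma linked_within_4:
  assumes "card Nin + card Nout \<ge> 2 \<or> card Nin + card Nout = 1 \<and> card N = 5"
  shows "\<exists>A\<subseteq>N. linked_within A 4"
proof -
  have one: "\<exists>i. S = {i}" if "card S = 1" for S :: "'a set"
    using that by (auto simp: card_1_singleton_iff)
  have dual: ?thesis if "\<exists>A\<subseteq>N. hub.linked_within V (T\<inverse>) u N A 4"
    using that dual_linked_within by blast
  consider "card Nin \<ge> 2" | "card Nout \<ge> 2" | "card Nin = 1" "card Nout = 1"
    | "card Nin = 1" "card N = 5" | "card Nout = 1" "card N = 5"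
    using assms by linarith
  then show ?thesis
  proof cases
    case 1
    then show ?thesis by (rule linked_within_4_if_two_in)
  next
    case 2
    then show ?thesis
      using hub.linked_within_4_if_two_in[OF hub_converse] dual by (simp add: dual_Nin)
  next
    case 3
    then show ?thesis using one linked_within_4_if_in_and_out by metis
  next
    case 4
    then show ?thesis using one linked_within_4_if_one_in_degree_five by metis
  next
    case 5
    then obtain i where "Nout = {i}" using one by blast
    then show ?thesis
      using hub.linked_within_4_if_one_in_degree_five[OF hub_converse] 5 dual by (simp add: dual_Nin)
  qed
qed

text \<open>A vertex of \<open>A\<close> leaves through a vertex of \<open>N - A\<close>, and a
  vertex of \<open>N - A\<close> is entered through one of \<open>A\<close>; so each half of a route
  needs only two vertices of \<open>N\<close>.\<close>

lemma linked_within_4_if_paired: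
  assumes "A \<subseteq> N"
    and out: "\<And>a. a \<in> A \<Longrightarrow> \<exists>b\<in>N - A. \<exists>W. via F W a b \<and> W \<inter> N \<subseteq> {a, b}"
    and into: "\<And>b. b \<in> N - A \<Longrightarrow> \<exists>a\<in>A. \<exists>W. via F W a b \<and> W \<inter> N \<subseteq> {a, b}"
  shows "linked_within A 4"
proof -
  have uN: "u \<notin> N" using N_V by auto
  \<comment> \<open>The sets in the hypotheses may exceed \<open>V\<close>, but \<open>F\<close>
    does not.\<close>
  have inV: "via F (W \<inter> V) x y" if "via F W x y" "x \<in> V" "y \<in> V" for W x y
  proof -
    have "F \<inter> W \<times> W = F \<inter> (W \<inter> V) \<times> (W \<inter> V)" using F_V by auto
    then show ?thesis using that by (simp add: via_def)
  qed
  have to_u: "\<exists>W\<subseteq>V. \<exists>w. via (reorient A) W z u \<and> W \<inter> N \<subseteq> {z, w}" if "z \<in> N" for z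
  proof (cases "z \<in> A")
    case True
    then obtain b W where b: "b \<in> N - A" "via F W z b" "W \<inter> N \<subseteq> {z, b}" using out[of z] by blast
    then have bV: "b \<in> V" "z \<in> V" using N_V that by auto
    have "via (reorient A) (W \<inter> V \<union> {b, u}) z u"
      using via_trans[OF via_F[OF inV[OF b(2) bV(2,1)]] in_hub] b(1) by simp
    then show ?thesis using b bV uN u_V
      by (intro exI[of _ "W \<inter> V \<union> {b, u}"] conjI exI[of _ b]) auto
  next
    case False
    then show ?thesis using in_hub[of z A] that uN N_V u_V by (intro exI[of _ "{z, u}"]) auto
  qed
  have from_u: "\<exists>W\<subseteq>V. \<exists>w. via (reorient A) W u z \<and> W \<inter> N \<subseteq> {z, w}" if "z \<in> N" for z
  proof (cases "z \<in> A")
    case False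
    then obtain a W where a: "a \<in> A" "via F W a z" "W \<inter> N \<subseteq> {a, z}" using into[of z] \<open>z \<in> N\<close> by blast
    then have aV: "a \<in> V" "z \<in> V" using N_V that assms(1) by auto
    have "via (reorient A) ({u, a} \<union> W \<inter> V) u z"
      using via_trans[OF out_hub via_F[OF inV[OF a(2) aV]]] a(1) by simp
    then show ?thesis using a aV uN u_V
      by (intro exI[of _ "{u, a} \<union> W \<inter> V"] conjI exI[of _ a]) auto
  next
    case True
    then show ?thesis using out_hub[of z A] that uN N_V u_V by (intro exI[of _ "{u, z}"]) auto
  qed
  have to_x: "\<exists>W\<subseteq>V. \<exists>v w. via (reorient A) W x u \<and> W \<inter> N \<subseteq> {v, w}" if "x \<in> V" for x
    using first_N[OF that, of A]
  proof (elim disjE exE conjE bexE)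
    fix z W assume z: "z \<in> N" and W: "W \<subseteq> V" "via F W x z" "W \<inter> N \<subseteq> {z}"
    obtain W' w where W': "W' \<subseteq> V" "via (reorient A) W' z u" "W' \<inter> N \<subseteq> {z, w}"
      using to_u[OF z] by blast
    show ?thesis using via_trans[OF via_F[OF W(2)] W'(2)] W W'
      by (intro exI[of _ "W \<union> W'"] conjI exI[of _ z] exI[of _ w]) auto
  qed auto
  have from_y: "\<exists>W\<subseteq>V. \<exists>v w. via (reorient A) W u y \<and> W \<inter> N \<subseteq> {v, w}" if "y \<in> V" for y
    using last_N[OF that assms(1)]
  proof (elim disjE exE conjE bexE)
    fix z W assume z: "z \<in> N" and W: "W \<subseteq> V" "via F W z y" "W \<inter> N \<subseteq> {z}"
    obtain W' w where W': "W' \<subseteq> V" "via (reorient A) W' u z" "W' \<inter> N \<subseteq> {z, w}"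
      using from_u[OF z] by blast
    show ?thesis using via_trans[OF W'(2) via_F[OF W(2)]] W W'
      by (intro exI[of _ "W' \<union> W"] conjI exI[of _ z] exI[of _ w]) auto
  qed auto
  show ?thesis
    unfolding linked_within_def
  proof (intro ballI)
    fix x y assume xy: "x \<in> V" "y \<in> V"
    obtain W v w where W: "W \<subseteq> V" "via (reorient A) W x u" "W \<inter> N \<subseteq> {v, w}"
      using to_x[OF xy(1)] by blast
    obtain W' v' w' where W': "W' \<subseteq> V" "via (reorient A) W' u y" "W' \<inter> N \<subseteq> {v', w'}"
      using from_y[OF xy(2)] by blast
    have "(W \<union> W') \<inter> N \<subseteq> {v, w, v', w'}" using W(3) W'(3) by auto
    then have "card ((W \<union> W') \<inter> N) \<le> card {v, w, v', w'}" by (intro card_mono) auto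
    also have "\<dots> \<le> 4" by (simp add: card_insert_if)
    finally show "\<exists>W\<subseteq>V. via (reorient A) W x y \<and> card W + card N \<le> card V + 4"
      using via_trans[OF W(2) W'(2)] W W' card_meet_N[of "W \<union> W'"]
      by (intro exI[of _ "W \<union> W'"]) simp
  qed
qed

end

section \<open>Alternating orientations of a forest\<close>

text \<open>In each component that meets \<open>N\<close> a root in \<open>N\<close> is chosen;
  \<open>rk\<close> is the distance from the root and \<open>par\<close> a neighbour closer to
  it.\<close>

lemma rooted_forest:
  fixes E :: "'a rel" and N :: "'a set"
  assumes "sym E"
  obtains par :: "'a \<Rightarrow> 'a" and rk :: "'a \<Rightarrow> nat" and S where
    "S \<subseteq> N"
    "\<And>z. (\<exists>r\<in>N. (r, z) \<in> E\<^sup>*) \<Longrightarrow> z \<notin> S \<Longrightarrow> (z, par z) \<in> E \<and> rk (par z) < rk z"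
    "\<And>s z. s \<in> S \<Longrightarrow> z \<in> S \<Longrightarrow> (s, z) \<in> E\<^sup>* \<Longrightarrow> s = z"
proof -
  define rt where "rt z = (SOME r. r \<in> N \<and> (r, z) \<in> E\<^sup>*)" for z
  define rk where "rk z = (LEAST n. (rt z, z) \<in> E ^^ n)" for z
  define S where "S = {z. (\<exists>r\<in>N. (r, z) \<in> E\<^sup>*) \<and> rt z = z}"
  define par where "par z = (SOME p. (p, z) \<in> E \<and> rk p < rk z)" for z
  have symE: "(x, y) \<in> E\<^sup>* \<Longrightarrow> (y, x) \<in> E\<^sup>*" for x y
    using assms sym_rtrancl by (metis symD)
  have rt: "rt z \<in> N \<and> (rt z, z) \<in> E\<^sup>*" if "\<exists>r\<in>N. (r, z) \<in> E\<^sup>*" for z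
    unfolding rt_def by (rule someI_ex) (use that in blast)
  \<comment> \<open>Throughout a component \<open>SOME\<close> is applied to the same predicate, so
    the roots agree.\<close>
  have rt_eq: "rt z = rt w" if "(z, w) \<in> E\<^sup>*" for z w
  proof -
    have "(r, z) \<in> E\<^sup>* \<longleftrightarrow> (r, w) \<in> E\<^sup>*" for r
      using rtrancl_trans[of r z E w] rtrancl_trans[of r w E z] that symE[OF that] by blast
    then show ?thesis by (simp add: rt_def)
  qed
  show thesis
  proof
    show "S \<subseteq> N"
    proof
      fix z assume "z \<in> S"
      then show "z \<in> N" using rt[of z] by (simp add: S_def)
    qed
    show "s = z" if "s \<in> S" "z \<in> S" "(s, z) \<in> E\<^sup>*" for s z
      using that rt_eq[OF that(3)] by (simp add: S_def)
    show "(z, par z) \<in> E \<and> rk (par z) < rk z" if z: "\<exists>r\<in>N. (r, z) \<in> E\<^sup>*" "z \<notin> S" for z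
    proof -
      have ne: "rt z \<noteq> z" using z by (simp add: S_def)
      have "(rt z, z) \<in> E\<^sup>*" using rt[OF z(1)] by blast
      then obtain n where "(rt z, z) \<in> E ^^ n" using rtrancl_imp_relpow by metis
      then have least: "(rt z, z) \<in> E ^^ rk z" unfolding rk_def by (rule LeastI)
      with ne obtain m where m: "rk z = Suc m" by (cases "rk z") auto
      then obtain p where p: "(rt z, p) \<in> E ^^ m" "(p, z) \<in> E" using least by auto
      have "rt p = rt z" using rt_eq p(2) by blast
      then have "rk p \<le> m" using p(1) unfolding rk_def by (intro Least_le) simp
      then have "\<exists>p. (p, z) \<in> E \<and> rk p < rk z" using p(2) m by auto
      then have "(par z, z) \<in> E \<and> rk (par z) < rk z" unfolding par_def by (rule someI_ex)
      then show ?thesis using assms by (meson symD)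
    qed
  qed
qed

text \<open>Well-founded recursion along \<open>rk\<close>: the equation is restricted to vertices
  with a parent of smaller rank because \<open>wfrec\<close> sees the colouring only below the
  current rank.\<close>

lemma alternating_colouring:
  fixes rk :: "'a \<Rightarrow> nat"
  obtains col :: "'a \<Rightarrow> bool" where
    "\<And>z. rk (par z) < rk z \<Longrightarrow> z \<notin> S \<Longrightarrow> col z = (if z \<in> N then \<not> col (par z) else col (par z))"
    "\<And>z. z \<in> S \<Longrightarrow> col z"
proof -
  define H where "H f z = (if z \<in> S then True else if z \<in> N then \<not> f (par z) else f (par z))"
    for f :: "'a \<Rightarrow> bool" and z
  define col where "col = wfrec (measure rk) H"
  have rec: "col z = H (cut col (measure rk) z) z" for z
    unfolding col_def by (rule wfrec[OF wf_measure])
  show thesis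
  proof (rule that[of col])
    show "col z = (if z \<in> N then \<not> col (par z) else col (par z))" if "rk (par z) < rk z" "z \<notin> S" for z
      unfolding rec[of z] using that by (simp add: H_def cut_def)
    show "col z" if "z \<in> S" for z
      unfolding rec[of z] using that by (simp add: H_def)
  qed
qed

text \<open>\<open>P\<close> maps each vertex of a rooted spanning forest to its parent, and \<open>Z\<close> consists of the
  vertices above some vertex of \<open>N\<close>. The colour flips at each vertex of \<open>N\<close>, and edges point downwards
  below coloured vertices and upwards below the others.\<close>
lemma alternating_orientation:
  fixes E :: "'a rel" and N :: "'a set"
  assumes "sym E" and partner: "\<And>v. v \<in> N \<Longrightarrow> \<exists>w\<in>N. w \<noteq> v \<and> (v, w) \<in> E\<^sup>*"
  obtains R A where "R \<subseteq> E" "\<And>x y. (x, y) \<in> R \<Longrightarrow> (y, x) \<notin> R" "A \<subseteq> N"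
    "\<And>a. a \<in> A \<Longrightarrow> \<exists>b\<in>N - A. \<exists>W. via R W a b \<and> W \<inter> N \<subseteq> {a, b}"
    "\<And>b. b \<in> N - A \<Longrightarrow> \<exists>a\<in>A. \<exists>W. via R W a b \<and> W \<inter> N \<subseteq> {a, b}"
    "\<And>x y. (x, y) \<in> R \<Longrightarrow> (\<exists>a\<in>A. (a, x) \<in> R\<^sup>*) \<and> (\<exists>b\<in>N - A. (y, b) \<in> R\<^sup>*)"
proof -
  obtain par :: "'a \<Rightarrow> 'a" and rk :: "'a \<Rightarrow> nat" and S where S: "S \<subseteq> N"
    and par: "\<And>z. (\<exists>r\<in>N. (r, z) \<in> E\<^sup>*) \<Longrightarrow> z \<notin> S \<Longrightarrow> (z, par z) \<in> E \<and> rk (par z) < rk z"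
    and root: "\<And>s z. s \<in> S \<Longrightarrow> z \<in> S \<Longrightarrow> (s, z) \<in> E\<^sup>* \<Longrightarrow> s = z"
    by (rule rooted_forest[OF assms(1), of N]) (rule that, assumption+)
  obtain col where col: "\<And>z. rk (par z) < rk z \<Longrightarrow> z \<notin> S \<Longrightarrow> col z = (if z \<in> N then \<not> col (par z) else col (par z))"
    and col_root: "\<And>z. z \<in> S \<Longrightarrow> col z"
    by (rule alternating_colouring[of rk par S N]) (rule that, assumption+)
  define C where "C = {z. \<exists>r\<in>N. (r, z) \<in> E\<^sup>*}"
  define P where "P = {(z, par z) | z. z \<in> C - S}"
  define Z where "Z = {z. \<exists>v\<in>N. (v, z) \<in> P\<^sup>*}"
  define R where "R = {(par z, z) | z. z \<in> Z - S \<and> col (par z)} \<union> {(z, par z) | z. z \<in> Z - S \<and> \<not> col (par z)}"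
  \<comment> \<open>A vertex of \<open>N\<close> differs in colour from its parent, if it has one,
    so the edges of \<open>R\<close> at it all leave it or all enter it: those in \<open>A\<close>
    are sources and the others sinks.\<close>
  define A where "A = {z \<in> N. col z}"
  have NC: "N \<subseteq> C" and NZ: "N \<subseteq> Z" by (auto simp: C_def Z_def)
  have parC: "par z \<in> C \<and> (z, par z) \<in> E \<and> rk (par z) < rk z" if "z \<in> C - S" for z
    using par[of z] that unfolding C_def by (auto intro: rtrancl_into_rtrancl)
  have PE: "P \<subseteq> E" using parC by (auto simp: P_def)
  have ZC: "Z \<subseteq> C"
  proof
    fix z assume "z \<in> Z"
    then obtain v where "v \<in> N" "(v, z) \<in> P\<^sup>*" by (auto simp: Z_def)
    then show "z \<in> C" using rtrancl_mono[OF PE] by (auto simp: C_def)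
  qed
  have parZ: "par z \<in> Z" if "z \<in> Z - S" for z
  proof -
    have "(z, par z) \<in> P" using that ZC by (auto simp: P_def)
    then show ?thesis using that by (auto simp: Z_def intro: rtrancl_into_rtrancl)
  qed
  have colZ: "col z = (if z \<in> N then \<not> col (par z) else col (par z))" if "z \<in> Z - S" for z
    using col[of z] parC[of z] that ZC by blast
  have down: "(par z, z) \<in> R" if "z \<in> Z - S" "col (par z)" for z using that by (auto simp: R_def)
  have up: "(z, par z) \<in> R" if "z \<in> Z - S" "\<not> col (par z)" for z using that by (auto simp: R_def)
  \<comment> \<open>The colour is constant on the tree path up to the nearest vertex of
    \<open>N\<close>, which exists because the roots lie in \<open>N\<close>; the path is therefore
    directed consistently.\<close>
  have above: "(col z \<longrightarrow> (\<exists>a\<in>A. \<exists>W. via R W a z \<and> W \<inter> N \<subseteq> {a})) \<and>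
      (\<not> col z \<longrightarrow> (\<exists>b\<in>N - A. \<exists>W. via R W z b \<and> W \<inter> N \<subseteq> {b}))" if "z \<in> Z" for z
    using that
  proof (induction "rk z" arbitrary: z rule: less_induct)
    case less
    show ?case
    proof (cases "z \<in> N")
      case True
      then show ?thesis by (auto simp: A_def intro!: bexI[of _ z] exI[of _ "{z}"] via_refl)
    next
      case False
      then have z: "z \<in> Z - S" using less.prems S by blast
      then have c: "col (par z) = col z" using colZ False by simp
      have "rk (par z) < rk z" "par z \<in> Z" using parC parZ z ZC by blast+
      note IH = less.hyps[OF this]
      show ?thesis
      proof (intro conjI impI)
        assume "col z"
        then obtain a W where a: "a \<in> A" "via R W a (par z)" "W \<inter> N \<subseteq> {a}" using IH c by auto
        have "via R (W \<union> {par z, z}) a z" using via_trans[OF a(2) via_step[OF down[OF z]]] c \<open>col z\<close> by simp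
        moreover have "par z \<in> W" using a(2) by (simp add: via_def)
        ultimately show "\<exists>a\<in>A. \<exists>W. via R W a z \<and> W \<inter> N \<subseteq> {a}"
          using a False by (intro bexI[of _ a] exI[of _ "W \<union> {par z, z}"]) auto
      next
        assume "\<not> col z"
        then obtain b W where b: "b \<in> N - A" "via R W (par z) b" "W \<inter> N \<subseteq> {b}" using IH c by auto
        have "via R ({z, par z} \<union> W) z b" using via_trans[OF via_step[OF up[OF z]] b(2)] c \<open>\<not> col z\<close> by simp
        moreover have "par z \<in> W" using b(2) by (simp add: via_def)
        ultimately show "\<exists>b\<in>N - A. \<exists>W. via R W z b \<and> W \<inter> N \<subseteq> {b}"
          using b False by (intro bexI[of _ b] exI[of _ "{z, par z} \<union> W"]) auto
      qed
    qed
  qed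
  \<comment> \<open>The counterpart for paths downwards. It passes from child to parent, starting
    from the vertices of \<open>N\<close>; here \<open>z\<close> itself may lie in
    \<open>N\<close>.\<close>
  define low where "low z \<longleftrightarrow> (col z \<longrightarrow> (\<exists>b\<in>N - A. \<exists>W. via R W z b \<and> W \<inter> N \<subseteq> {z, b})) \<and>
      (\<not> col z \<longrightarrow> (\<exists>a\<in>A. \<exists>W. via R W a z \<and> W \<inter> N \<subseteq> {a, z}))" for z
  have low_par: "low (par y)" if y: "y \<in> Z - S" and "y \<in> N \<or> low y" for y
  proof (cases "y \<in> N")
    case True
    then have c: "col y = (\<not> col (par y))" using colZ y by simp
    have "via R {par y, y} (par y) y" if "col (par y)" using via_step[OF down[OF y that]] .
    moreover have "via R {y, par y} y (par y)" if "\<not> col (par y)" using via_step[OF up[OF y that]] .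
    ultimately show ?thesis using True c unfolding low_def
      by (intro conjI impI bexI[of _ y] exI[of _ "{y, par y}"]) (auto simp: A_def insert_commute)
  next
    case False
    then have c: "col y = col (par y)" and l: "low y" using colZ y that(2) by simp_all
    show ?thesis
      unfolding low_def
    proof (intro conjI impI)
      assume "col (par y)"
      then obtain b W where b: "b \<in> N - A" "via R W y b" "W \<inter> N \<subseteq> {y, b}"
        using l c by (auto simp: low_def)
      have "via R ({par y, y} \<union> W) (par y) b"
        using via_trans[OF via_step[OF down[OF y \<open>col (par y)\<close>]] b(2)] .
      then show "\<exists>b\<in>N - A. \<exists>W. via R W (par y) b \<and> W \<inter> N \<subseteq> {par y, b}"
        using b False by (intro bexI[of _ b] exI[of _ "{par y, y} \<union> W"]) auto
    next
      assume nc: "\<not> col (par y)"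
      then obtain a W where a: "a \<in> A" "via R W a y" "W \<inter> N \<subseteq> {a, y}"
        using l c by (auto simp: low_def)
      have "via R (W \<union> {y, par y}) a (par y)"
        using via_trans[OF a(2) via_step[OF up[OF y nc]]] .
      then show "\<exists>a\<in>A. \<exists>W. via R W a (par y) \<and> W \<inter> N \<subseteq> {a, par y}"
        using a False by (intro bexI[of _ a] exI[of _ "W \<union> {y, par y}"]) auto
    qed
  qed
  have low: "z = v \<or> low z" if "v \<in> N" "(v, z) \<in> P\<^sup>*" for v z
    using that(2)
  proof (induction rule: rtrancl_induct)
    case (step y z)
    have z: "z = par y" "y \<in> C - S" using step(2) by (auto simp: P_def)
    have "y \<in> Z" using step(1) that(1) by (auto simp: Z_def)
    then show ?case using low_par[of y] step.IH that(1) z by auto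
  qed simp
  have low': "low z" if "z \<in> Z - N" for z
    using that low by (auto simp: Z_def)
  \<comment> \<open>A root cannot use a path upwards. Its partner lies in the same component and
    hence below it, since the component has no other root.\<close>
  have root_low: "low s" if s: "s \<in> S" for s
  proof -
    obtain w where w: "w \<in> N" "w \<noteq> s" "(s, w) \<in> E\<^sup>*" using partner[of s] s S by blast
    have "\<exists>r\<in>S. (z, r) \<in> P\<^sup>*" if "z \<in> C" for z
      using that
    proof (induction "rk z" arbitrary: z rule: less_induct)
      case less
      show ?case
      proof (cases "z \<in> S")
        case False
        with less.prems have z: "z \<in> C - S" by blast
        then have "\<exists>r\<in>S. (par z, r) \<in> P\<^sup>*" using less.hyps parC by blast
        moreover have "(z, par z) \<in> P" using z by (auto simp: P_def)
        ultimately show ?thesis by (meson converse_rtrancl_into_rtrancl)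
      qed auto
    qed
    then obtain r where r: "r \<in> S" "(w, r) \<in> P\<^sup>*" using w(1) NC by blast
    then have "(s, r) \<in> E\<^sup>*" using w(3) rtrancl_mono[OF PE] by (meson rtrancl_trans subsetD)
    then have "r = s" using root s r by blast
    then show ?thesis using low[OF w(1) r(2)] w(2) by simp
  qed
  show thesis
  proof
    show "A \<subseteq> N" by (auto simp: A_def)
    show "R \<subseteq> E" using parC ZC assms(1) by (auto simp: R_def dest: symD)
    show "(y, x) \<notin> R" if "(x, y) \<in> R" for x y
    proof
      assume yx: "(y, x) \<in> R"
      have rkP: "rk (par z) < rk z" if "z \<in> Z - S" for z using parC that ZC by blast
      have edge: "(q \<in> Z - S \<and> p = par q \<and> col p) \<or> (p \<in> Z - S \<and> q = par p \<and> \<not> col q)"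
        if "(p, q) \<in> R" for p q
        using that by (auto simp: R_def)
      show False
        using edge[OF that] edge[OF yx] rkP[of x] rkP[of y] by (metis less_asym)
    qed
    show "\<exists>b\<in>N - A. \<exists>W. via R W a b \<and> W \<inter> N \<subseteq> {a, b}" if a: "a \<in> A" for a
    proof (cases "a \<in> S")
      case True
      then show ?thesis using root_low[OF True] col_root[OF True] by (auto simp: low_def)
    next
      case False
      have aZ: "a \<in> Z - S" "a \<in> N" "col a" using a NZ False by (auto simp: A_def)
      then have c: "\<not> col (par a)" using colZ by simp
      then obtain b W where b: "b \<in> N - A" "via R W (par a) b" "W \<inter> N \<subseteq> {b}"
        using above parZ[OF aZ(1)] by blast
      have "via R ({a, par a} \<union> W) a b" using via_trans[OF via_step[OF up[OF aZ(1) c]] b(2)] .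
      moreover have "par a \<in> W" using b(2) by (simp add: via_def)
      ultimately show ?thesis using b by (intro bexI[of _ b] exI[of _ "{a, par a} \<union> W"]) auto
    qed
    show "\<exists>a\<in>A. \<exists>W. via R W a b \<and> W \<inter> N \<subseteq> {a, b}" if b: "b \<in> N - A" for b
    proof -
      have bZ: "b \<in> Z - S" "b \<in> N" "\<not> col b" using b NZ col_root by (auto simp: A_def)
      then have c: "col (par b)" using colZ by simp
      then obtain a W where a: "a \<in> A" "via R W a (par b)" "W \<inter> N \<subseteq> {a}"
        using above parZ[OF bZ(1)] by blast
      have "via R (W \<union> {par b, b}) a b" using via_trans[OF a(2) via_step[OF down[OF bZ(1) c]]] .
      moreover have "par b \<in> W" using a(2) by (simp add: via_def)
      ultimately show ?thesis using a by (intro bexI[of _ a] exI[of _ "W \<union> {par b, b}"]) auto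
    qed
    have viaD: "(x, y) \<in> R\<^sup>*" if "via R W x y" for W x y
      using that rtrancl_mono[of "R \<inter> W \<times> W" R] by (auto simp: via_def)
    \<comment> \<open>Every arc lies on a walk from \<open>A\<close> to \<open>N - A\<close>, which
      can later be closed through \<open>u\<close>.\<close>
    show "(\<exists>a\<in>A. (a, x) \<in> R\<^sup>*) \<and> (\<exists>b\<in>N - A. (y, b) \<in> R\<^sup>*)" if xy: "(x, y) \<in> R" for x y
    proof -
      consider "y \<in> Z - S" "x = par y" "col x" | "x \<in> Z - S" "y = par x" "\<not> col y"
        using xy by (auto simp: R_def)
      then show ?thesis
      proof cases
        case 1
        then have "\<exists>a\<in>A. (a, x) \<in> R\<^sup>*" using above[of x] parZ[of y] viaD by blast
        moreover have "\<exists>b\<in>N - A. (y, b) \<in> R\<^sup>*"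
        proof (cases "y \<in> N")
          case True
          then have "y \<in> N - A" using colZ[of y] 1 by (simp add: A_def)
          then show ?thesis by blast
        next
          case False
          then have "low y" "col y" using low' colZ[of y] 1 by auto
          then show ?thesis using viaD by (auto simp: low_def)
        qed
        ultimately show ?thesis ..
      next
        case 2
        then have "\<exists>b\<in>N - A. (y, b) \<in> R\<^sup>*" using above[of y] parZ[of x] viaD by blast
        moreover have "\<exists>a\<in>A. (a, x) \<in> R\<^sup>*"
        proof (cases "x \<in> N")
          case True
          then have "x \<in> A" using colZ[of x] 2 by (simp add: A_def)
          then show ?thesis by blast
        next
          case False
          then have "low x" "\<not> col x" using low' colZ[of x] 2 by auto
          then show ?thesis using viaD by (auto simp: low_def)
        qed
        ultimately show ?thesis by blast
      qed
    qed
  qed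
qed

section \<open>Mixed graphs\<close>

lemma reach_with_proj:
  assumes "parcs D \<subseteq> pverts D \<times> pverts D"
  shows "x \<rightarrow>\<^sup>*\<^bsub>with_proj D\<^esub> y \<longleftrightarrow> x \<in> pverts D \<and> y \<in> pverts D \<and> (x, y) \<in> (parcs D)\<^sup>*"
proof -
  interpret pair_wf_digraph D
    using assms by unfold_locales auto
  show ?thesis
  proof (intro iffI conjI; (elim conjE)?)
    assume r: "x \<rightarrow>\<^sup>*\<^bsub>with_proj D\<^esub> y"
    show "x \<in> pverts D" "y \<in> pverts D" using reachable_in_verts[OF r] by auto
    show "(x, y) \<in> (parcs D)\<^sup>*"
      using r unfolding reachable_def by (auto dest: rtrancl_on_rtranclI)
  next
    assume "x \<in> pverts D" "y \<in> pverts D" "(x, y) \<in> (parcs D)\<^sup>*"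
    then show "x \<rightarrow>\<^sup>*\<^bsub>with_proj D\<^esub> y"
      unfolding reachable_def using assms by (intro rtrancl_consistent_rtrancl_on) auto
  qed
qed

text \<open>A symmetric digraph is its own symmetric closure, so connectedness is strong
  connectedness here.\<close>

lemma connected_with_proj:
  assumes "parcs D \<subseteq> pverts D \<times> pverts D" "sym (parcs D)"
  shows "Digraph_Component.connected (with_proj D) \<longleftrightarrow>
    pverts D \<noteq> {} \<and> (\<forall>x\<in>pverts D. \<forall>y\<in>pverts D. (x, y) \<in> (parcs D)\<^sup>*)"
proof -
  have "mk_symmetric (with_proj D) = D"
    using assms(2) by (intro pair_pre_digraph.equality) (auto simp: mk_symmetric_def with_proj_def sym_def)
  then show ?thesis
    by (auto simp: connected_def strongly_connected_def reach_with_proj[OF assms(1)])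
qed

text \<open>A simple path in the subgraph with vertex set \<open>W\<close> visits at most
  \<open>card W\<close> vertices, hence has at most one arc fewer, and it remains a simple path in
  \<open>D\<close>.\<close>

lemma distance_le:
  assumes "via (parcs D) W x y" "W \<subseteq> pverts D" "finite W"
  shows "distance D x y \<le> enat (card W - 1)"
proof -
  let ?H = "\<lparr>pverts = W, parcs = parcs D \<inter> W \<times> W\<rparr>"
  interpret H: pair_wf_digraph ?H
    by unfold_locales auto
  have "x \<rightarrow>\<^sup>*\<^bsub>with_proj ?H\<^esub> y"
    using assms(1) by (subst reach_with_proj) (auto simp: via_def)
  then obtain p where p: "pre_digraph.apath (with_proj ?H) x p y"
    using H.reachable_apath by blast
  have compat: "compatible (with_proj ?H) (with_proj D)"
    by (simp add: compatible_def with_proj_def)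
  have "pre_digraph.apath (with_proj D) x p y"
    using p assms(2)
    by (auto simp: pre_digraph.apath_def pre_digraph.awalk_def compatible_cas[OF compat]
        compatible_awalk_verts[OF compat])
  moreover have "length p \<le> card W - 1"
  proof -
    have "set (pre_digraph.awalk_verts (with_proj ?H) x p) \<subseteq> W"
      using p unfolding H.apath_def H.awalk_conv by simp
    then have "card (set (pre_digraph.awalk_verts (with_proj ?H) x p)) \<le> card W"
      using assms(3) by (rule card_mono[rotated])
    moreover have "distinct (pre_digraph.awalk_verts (with_proj ?H) x p)"
      using p by (simp add: H.apath_def)
    ultimately show ?thesis
      by (simp add: distinct_card H.length_awalk_verts)
  qed
  ultimately show ?thesis
    unfolding distance_def by (intro INF_lower2[of p]) auto
qed

lemma chain_rtrancl:
  assumes "p \<noteq> []" "\<And>i. Suc i < length p \<Longrightarrow> (p ! i, p ! Suc i) \<in> R"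
  shows "(hd p, last p) \<in> R\<^sup>*"
  using assms
proof (induction p)
  case (Cons a p)
  show ?case
  proof (cases "p = []")
    case False
    have "(hd p, last p) \<in> R\<^sup>*"
    proof (rule Cons.IH[OF False])
      show "(p ! i, p ! Suc i) \<in> R" if "Suc i < length p" for i
        using Cons.prems(2)[of "Suc i"] that by simp
    qed
    moreover have "(a, hd p) \<in> R"
      using Cons.prems(2)[of 0] False by (simp add: hd_conv_nth)
    ultimately show ?thesis using False by (simp add: converse_rtrancl_into_rtrancl)
  qed simp
qed simp

section \<open>Strong orientations of bridgeless mixed graphs\<close>

context mixed_graph
begin

definition E :: "'a rel" where
  "E = {(x, y). {x, y} \<in> medges G}"

definition nbrs :: "'a \<Rightarrow> 'a set" where
  "nbrs u = {v. {u, v} \<in> medges G}"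

lemma sym_E: "sym E"
  by (auto simp: E_def sym_def insert_commute)

lemma irrefl_E: "irrefl E"
  by (auto simp: E_def irrefl_def dest!: medges_wf)

lemma E_V: "E \<subseteq> mverts G \<times> mverts G"
  using medges_wf by (auto simp: E_def)

lemma marcs_V: "marcs G \<subseteq> mverts G \<times> mverts G"
  using marcs_wf by auto

lemma finite_E: "finite E"
  using E_V finite_mverts finite_subset by blast

lemma marcs_E: "marcs G \<inter> E = {}"
  using no_marc_parallel_medge by (auto simp: E_def)

lemma undirected_degree_nbrs: "undirected_degree G u = card (nbrs u)"
proof -
  have "{e \<in> medges G. u \<in> e} = (\<lambda>v. {u, v}) ` nbrs u"
  proof (intro equalityI subsetI)
    fix e assume "e \<in> {e \<in> medges G. u \<in> e}"
    then have e: "e \<in> medges G" "card e = 2" "u \<in> e" using medges_wf by auto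
    then obtain v where "e = {u, v}" by (auto simp: card_2_iff)
    with e show "e \<in> (\<lambda>v. {u, v}) ` nbrs u" by (auto simp: nbrs_def)
  qed (auto simp: nbrs_def)
  moreover have "inj_on (\<lambda>v. {u, v}) (nbrs u)"
    by (auto simp: inj_on_def doubleton_eq_iff)
  ultimately show ?thesis by (simp add: undirected_degree_def card_image)
qed

lemma in_arc_degree_card: "in_arc_degree G u = card {w. (w, u) \<in> marcs G}"
proof -
  have "{a \<in> marcs G. snd a = u} = (\<lambda>w. (w, u)) ` {w. (w, u) \<in> marcs G}" by auto
  then show ?thesis by (simp add: in_arc_degree_def card_image inj_on_def)
qed

lemma out_arc_degree_card: "out_arc_degree G u = card {w. (u, w) \<in> marcs G}"
proof -
  have "{a \<in> marcs G. fst a = u} = (\<lambda>w. (u, w)) ` {w. (u, w) \<in> marcs G}" by auto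
  then show ?thesis by (simp add: out_arc_degree_def card_image inj_on_def)
qed

lemma mconnected_rtrancl:
  assumes "mconnected G" "x \<in> mverts G" "y \<in> mverts G"
  shows "(x, y) \<in> (marcs G \<union> E)\<^sup>*"
proof -
  obtain p where p: "orientable_path G x p y" using assms by (auto simp: mconnected_def)
  then have "(hd p, last p) \<in> (marcs G \<union> E)\<^sup>*"
    by (intro chain_rtrancl) (auto simp: orientable_path_def E_def)
  then show ?thesis using p by (simp add: orientable_path_def)
qed

text \<open>Orientable paths connect the underlying graph; as the edge is no bridge, its deletion
  keeps the graph connected and leaves another way from \<open>x\<close> to
  \<open>y\<close>.\<close>

lemma detour:
  assumes "bridgeless G" "(x, y) \<in> E"
  shows "(x, y) \<in> (marcs G \<union> (marcs G)\<inverse> \<union> E - {(x, y), (y, x)})\<^sup>*"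
proof -
  have xy: "{x, y} \<in> medges G" "x \<in> mverts G" "y \<in> mverts G" using assms(2) E_V by (auto simp: E_def)
  have und: "parcs (underlying G) = marcs G \<union> (marcs G)\<inverse> \<union> E"
    by (auto simp: underlying_def E_def)
  \<comment> \<open>No arc is parallel to the edge, so the deletion removes both pairs from the
    underlying relation.\<close>
  have del: "parcs (underlying (delete_medge G {x, y})) = marcs G \<union> (marcs G)\<inverse> \<union> E - {(x, y), (y, x)}"
    using no_marc_parallel_medge[of x y] no_marc_parallel_medge[of y x] xy(1)
    by (auto simp: underlying_def delete_medge_def E_def doubleton_eq_iff insert_commute)
  have conn: "Digraph_Component.connected (with_proj (underlying G))"
  proof (subst connected_with_proj)
    show "parcs (underlying G) \<subseteq> pverts (underlying G) \<times> pverts (underlying G)"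
      unfolding und using E_V marcs_V by (auto simp: underlying_def)
    show "sym (parcs (underlying G))" unfolding und using sym_E by (auto simp: sym_def)
    have "marcs G \<union> E \<subseteq> marcs G \<union> (marcs G)\<inverse> \<union> E" by auto
    then have "(p, q) \<in> (parcs (underlying G))\<^sup>*" if "p \<in> mverts G" "q \<in> mverts G" for p q
      unfolding und using mconnected_rtrancl[OF _ that] assms(1) rtrancl_mono
      unfolding bridgeless_def by blast
    moreover have "pverts (underlying G) = mverts G" by (simp add: underlying_def)
    ultimately show "pverts (underlying G) \<noteq> {} \<and>
        (\<forall>x\<in>pverts (underlying G). \<forall>y\<in>pverts (underlying G). (x, y) \<in> (parcs (underlying G))\<^sup>*)"
      using xy(2) by auto
  qed
  then have "Digraph_Component.connected (with_proj (underlying (delete_medge G {x, y})))"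
    using assms(1) xy by (auto simp: bridgeless_def bridge_def)
  moreover have "sym (parcs (underlying (delete_medge G {x, y})))"
    unfolding del using sym_E by (auto simp: sym_def)
  moreover have "parcs (underlying (delete_medge G {x, y})) \<subseteq>
      pverts (underlying (delete_medge G {x, y})) \<times> pverts (underlying (delete_medge G {x, y}))"
    unfolding del using E_V marcs_V by (auto simp: underlying_def delete_medge_def)
  moreover have "pverts (underlying (delete_medge G {x, y})) = mverts G"
    by (simp add: underlying_def delete_medge_def)
  ultimately show ?thesis
    using xy connected_with_proj[of "underlying (delete_medge G {x, y})"] unfolding del by simp
qed

text \<open>The sets \<open>W\<close> provide strong connectivity and the diameter bound at once;
  \<open>Suc m\<close> vertices allow for \<open>m\<close> arcs.\<close>

lemma oriented_diameter_le:
  assumes Q: "marcs G \<subseteq> Q" "Q \<subseteq> marcs G \<union> E" "\<And>x y. (x, y) \<in> E \<Longrightarrow> ((x, y) \<in> Q) \<noteq> ((y, x) \<in> Q)"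
    and short: "\<And>x y. x \<in> mverts G \<Longrightarrow> y \<in> mverts G \<Longrightarrow>
      \<exists>W\<subseteq>mverts G. via Q W x y \<and> card W \<le> Suc m"
    and "mverts G \<noteq> {}"
  shows "oriented_diameter G \<le> enat m"
proof -
  let ?D = "\<lparr>pverts = mverts G, parcs = Q\<rparr>"
  have "orientation G ?D" using Q by (auto simp: orientation_def E_def)
  moreover have "strongly_connected (with_proj ?D)"
  proof -
    have "(x, y) \<in> Q\<^sup>*" if xy: "x \<in> mverts G" "y \<in> mverts G" for x y
    proof -
      obtain W where "via Q W x y" using short[OF xy] by blast
      moreover have "Q \<inter> W \<times> W \<subseteq> Q" by blast
      ultimately show ?thesis using rtrancl_mono unfolding via_def by blast
    qed
    moreover have "parcs ?D \<subseteq> pverts ?D \<times> pverts ?D" using Q(2) E_V marcs_V by auto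
    note reach_with_proj[OF this]
    ultimately show ?thesis using assms(5) by (simp add: strongly_connected_def)
  qed
  ultimately have "strong_orientation G ?D" by (simp add: strong_orientation_def)
  moreover have "diameter ?D \<le> enat m"
    unfolding diameter_def
  proof (rule SUP_least, clarify)
    fix x y assume "x \<in> pverts ?D" "y \<in> pverts ?D"
    then obtain W where W: "W \<subseteq> mverts G" "via Q W x y" "card W \<le> Suc m" using short[of x y] by auto
    have "distance ?D x y \<le> enat (card W - 1)"
      using W finite_mverts finite_subset by (intro distance_le) auto
    also have "\<dots> \<le> enat m" using W(3) by simp
    finally show "distance ?D x y \<le> enat m" .
  qed
  ultimately show ?thesis
    unfolding oriented_diameter_def by (intro INF_lower2[of ?D]) auto
qed

text \<open>The pairs of \<open>R\<close> are treated as additional arcs. By \<open>cyc\<close> the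
  reversed pairs are replaced by walks in \<open>R\<close>, so the mixed graph stays connected, and
  its underlying graph does not change; then \<open>mixed_robbins\<close> applies.\<close>

lemma orientation_extending:
  assumes "bridgeless G" "R \<subseteq> E" "\<And>x y. (x, y) \<in> R \<Longrightarrow> (y, x) \<notin> R"
    and cyc: "\<And>x y. (x, y) \<in> R \<Longrightarrow> (y, x) \<in> R\<^sup>*"
  obtains T where "marcs G \<union> R \<subseteq> T" "T \<subseteq> marcs G \<union> E"
    "\<And>x y. (x, y) \<in> E \<Longrightarrow> ((x, y) \<in> T) \<noteq> ((y, x) \<in> T)"
    "\<And>x y. x \<in> mverts G \<Longrightarrow> y \<in> mverts G \<Longrightarrow> (x, y) \<in> T\<^sup>*"
proof -
  define E1 where "E1 = E - R - R\<inverse>"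
  have "\<exists>T. marcs G \<union> R \<subseteq> T \<and> T \<subseteq> marcs G \<union> R \<union> E1 \<and>
    (\<forall>x y. (x, y) \<in> E1 \<longrightarrow> ((x, y) \<in> T) \<noteq> ((y, x) \<in> T)) \<and>
    (\<forall>x\<in>mverts G. \<forall>y\<in>mverts G. (x, y) \<in> T\<^sup>*)"
  proof (rule mixed_robbins)
    show "finite E1" using finite_E by (simp add: E1_def)
    show "sym E1" using sym_E by (auto simp: E1_def sym_def)
    show "(marcs G \<union> R) \<inter> E1 = {}" using marcs_E by (auto simp: E1_def)
    show "marcs G \<union> R \<subseteq> mverts G \<times> mverts G" "E1 \<subseteq> mverts G \<times> mverts G"
      using marcs_V E_V assms(2) by (auto simp: E1_def)
    show "irrefl E1" using irrefl_E by (auto simp: E1_def irrefl_def)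
    show "(x, y) \<in> (marcs G \<union> R \<union> E1)\<^sup>*" if "x \<in> mverts G" "y \<in> mverts G" for x y
    proof -
      have "R\<^sup>* \<subseteq> (marcs G \<union> R \<union> E1)\<^sup>*" by (rule rtrancl_mono) auto
      then have "marcs G \<union> E \<subseteq> (marcs G \<union> R \<union> E1)\<^sup>*" using cyc by (auto simp: E1_def)
      then show ?thesis
        using mconnected_rtrancl[OF _ that] assms(1) rtrancl_subset_rtrancl
        unfolding bridgeless_def by blast
    qed
    show "(x, y) \<in> (marcs G \<union> R \<union> (marcs G \<union> R)\<inverse> \<union> E1 - {(x, y), (y, x)})\<^sup>*"
      if "(x, y) \<in> E1" for x y
    proof -
      have "R\<inverse> \<subseteq> E" using assms(2) sym_E by (auto dest: symD)
      then have "marcs G \<union> R \<union> (marcs G \<union> R)\<inverse> \<union> E1 = marcs G \<union> (marcs G)\<inverse> \<union> E"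
        using assms(2) by (auto simp: E1_def)
      then show ?thesis using detour[OF assms(1)] that by (simp add: E1_def)
    qed
  qed
  then obtain T where T: "marcs G \<union> R \<subseteq> T" "T \<subseteq> marcs G \<union> R \<union> E1"
    "\<forall>x y. (x, y) \<in> E1 \<longrightarrow> ((x, y) \<in> T) \<noteq> ((y, x) \<in> T)"
    "\<forall>x\<in>mverts G. \<forall>y\<in>mverts G. (x, y) \<in> T\<^sup>*" by blast
  have RT: "(x, y) \<in> T \<and> (y, x) \<notin> T" if "(x, y) \<in> R" for x y
  proof -
    have "(y, x) \<in> E" using that assms(2) sym_E by (auto dest: symD)
    then have "(y, x) \<notin> marcs G" using marcs_E by blast
    then show ?thesis using that T(1,2) assms(3) by (auto simp: E1_def)
  qed
  show thesis
  proof (rule that[of T])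
    show "T \<subseteq> marcs G \<union> E" using T(2) assms(2) by (auto simp: E1_def)
    show "((x, y) \<in> T) \<noteq> ((y, x) \<in> T)" if "(x, y) \<in> E" for x y
      using that RT[of x y] RT[of y x] T(3) by (cases "(x, y) \<in> E1") (auto simp: E1_def)
  qed (use T in auto)
qed

section \<open>Transfer to the oriented diameter\<close>

context
  fixes T :: "'a rel" and u :: 'a
  assumes T: "marcs G \<subseteq> T" "T \<subseteq> marcs G \<union> E" "\<And>x y. (x, y) \<in> E \<Longrightarrow> ((x, y) \<in> T) \<noteq> ((y, x) \<in> T)"
      "\<And>x y. x \<in> mverts G \<Longrightarrow> y \<in> mverts G \<Longrightarrow> (x, y) \<in> T\<^sup>*"
    and u: "u \<in> mverts G"
begin

lemma nbrs_E: "v \<in> nbrs u \<longleftrightarrow> (u, v) \<in> E" "v \<in> nbrs u \<longleftrightarrow> (v, u) \<in> E"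
  by (auto simp: nbrs_def E_def insert_commute)

lemma hub_orientation: "hub (mverts G) T u (nbrs u)"
proof
  show "nbrs u \<subseteq> mverts G - {u}"
    using E_V irrefl_E by (auto simp: nbrs_E irrefl_def)
  show "(v, u) \<notin> T" if "(u, v) \<in> T" for v
  proof (cases "(u, v) \<in> E")
    case False
    moreover from this have "(v, u) \<notin> E" by (simp flip: nbrs_E)
    ultimately show ?thesis using that T(2) no_opposite_marcs by blast
  qed (use T(3) that in blast)
  show "T \<subseteq> mverts G \<times> mverts G" using T(2) E_V marcs_V by blast
qed (use T(4) u finite_mverts in auto)

interpretation hub "mverts G" T u "nbrs u" by (rule hub_orientation)

lemma Nin_marcs: "Nin = {w. (w, u) \<in> marcs G}" and Nout_marcs: "Nout = {w. (u, w) \<in> marcs G}"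
  using T(1,2) marcs_E by (auto simp: Nin_def nbrs_E(2)) (auto simp: Nout_def nbrs_E(1))

text \<open>Only edges at \<open>u\<close> are changed in \<open>T\<close>, so
  \<open>reorient A\<close> is again an orientation. The term \<open>Suc m\<close> reflects that
  \<open>linked_within\<close> bounds numbers of vertices and \<open>m\<close> a number of
  arcs.\<close>

lemma oriented_diameter_le_within:
  assumes "A \<subseteq> nbrs u" "linked_within A k" "card (mverts G) + k \<le> Suc m + undirected_degree G u"
  shows "oriented_diameter G \<le> enat m"
proof (rule oriented_diameter_le)
  show "marcs G \<subseteq> reorient A"
    using T(1) Nin_marcs Nout_marcs by (auto simp: reorient_def F_def)
  show "reorient A \<subseteq> marcs G \<union> E"
  proof -
    have "{u} \<times> A \<subseteq> E" using assms(1) by (auto simp: nbrs_E(1))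
    moreover have "(nbrs u - A) \<times> {u} \<subseteq> E" by (auto simp: nbrs_E(2))
    ultimately show ?thesis using T(2) unfolding reorient_def F_def Nin_marcs Nout_marcs by auto
  qed
  show "((x, y) \<in> reorient A) \<noteq> ((y, x) \<in> reorient A)" if xy: "(x, y) \<in> E" for x y
  proof -
    have not_arc: "(x, y) \<notin> marcs G" "(y, x) \<notin> marcs G"
      using xy marcs_E symD[OF sym_E xy] by auto
    have "x \<noteq> y" using xy irrefl_E by (auto simp: irrefl_def)
    consider "x = u" "y \<in> nbrs u" "y \<noteq> u" | "y = u" "x \<in> nbrs u" "x \<noteq> u" | "x \<noteq> u" "y \<noteq> u"
      using nbrs_E(1)[of y] nbrs_E(2)[of x] xy \<open>x \<noteq> y\<close> by (cases "x = u"; cases "y = u") simp_all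
    then show ?thesis
    proof cases
      case 3
      then have "(x, y) \<in> reorient A \<longleftrightarrow> (x, y) \<in> T" "(y, x) \<in> reorient A \<longleftrightarrow> (y, x) \<in> T"
        by (auto simp: reorient_def F_def)
      then show ?thesis using T(3)[OF xy] by simp
    qed (use not_arc assms(1) N_V in \<open>auto simp: reorient_def F_def Nin_marcs Nout_marcs\<close>)
  qed
  show "\<exists>W\<subseteq>mverts G. via (reorient A) W x y \<and> card W \<le> Suc m"
    if xy: "x \<in> mverts G" "y \<in> mverts G" for x y
  proof -
    obtain W where "W \<subseteq> mverts G" "via (reorient A) W x y"
      "card W + card (nbrs u) \<le> card (mverts G) + k"
      using assms(2) xy unfolding linked_within_def by blast
    then show ?thesis using assms(3) by (intro exI[of _ W]) (simp add: undirected_degree_nbrs)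
  qed
  show "mverts G \<noteq> {}" using u by auto
qed

lemma oriented_diameter_le_general:
  assumes "card (mverts G) + 4 \<le> m + undirected_degree G u"
  shows "oriented_diameter G \<le> enat m"
  using linked_within_5 oriented_diameter_le_within[of _ 5 m] assms by auto

lemma oriented_diameter_le_strong:
  assumes "in_arc_degree G u + out_arc_degree G u \<ge> 2 \<or>
      in_arc_degree G u + out_arc_degree G u = 1 \<and> undirected_degree G u = 5"
    and "card (mverts G) + 3 \<le> m + undirected_degree G u"
  shows "oriented_diameter G \<le> enat m"
proof -
  have "\<exists>A\<subseteq>nbrs u. linked_within A 4"
    using assms(1) by (intro linked_within_4)
      (simp add: in_arc_degree_card out_arc_degree_card undirected_degree_nbrs Nin_marcs Nout_marcs)
  then show ?thesis using oriented_diameter_le_within[of _ 4 m] assms(2) by auto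
qed

lemma oriented_diameter_le_paired:
  assumes "R0 \<subseteq> T" "R0 \<subseteq> {(x, y). x \<noteq> u \<and> y \<noteq> u}" "A \<subseteq> nbrs u"
    and "\<And>a. a \<in> A \<Longrightarrow> \<exists>b\<in>nbrs u - A. \<exists>W. via R0 W a b \<and> W \<inter> nbrs u \<subseteq> {a, b}"
    and "\<And>b. b \<in> nbrs u - A \<Longrightarrow> \<exists>a\<in>A. \<exists>W. via R0 W a b \<and> W \<inter> nbrs u \<subseteq> {a, b}"
    and "card (mverts G) + 3 \<le> m + undirected_degree G u"
  shows "oriented_diameter G \<le> enat m"
proof -
  have "R0 \<subseteq> F" using assms(1,2) by (auto simp: F_def)
  then have R0F: "via F W x y" if "via R0 W x y" for W x y
    using via_mono[OF that] by blast
  have "linked_within A 4"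
  proof (rule linked_within_4_if_paired[OF assms(3)])
    show "\<exists>b\<in>nbrs u - A. \<exists>W. via F W a b \<and> W \<inter> nbrs u \<subseteq> {a, b}" if "a \<in> A" for a
      using assms(4)[OF that] R0F by blast
    show "\<exists>a\<in>A. \<exists>W. via F W a b \<and> W \<inter> nbrs u \<subseteq> {a, b}" if "b \<in> nbrs u - A" for b
      using assms(5)[OF that] R0F by blast
  qed
  then show ?thesis using oriented_diameter_le_within[of A 4 m] assms(3,6) by auto
qed

end

section \<open>Undirected graphs\<close>

text \<open>Since the edge between \<open>u\<close> and \<open>v\<close> is no bridge, some path
  leads from \<open>v\<close> to \<open>u\<close> without it. Its last vertex before the first visit
  to \<open>u\<close> is another neighbour of \<open>u\<close>, joined to \<open>v\<close> in the
  graph without \<open>u\<close>.\<close>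

lemma undirected_partner:
  assumes "bridgeless G" "marcs G = {}" "v \<in> nbrs u"
  shows "\<exists>w\<in>nbrs u. w \<noteq> v \<and> (v, w) \<in> {(x, y) \<in> E. x \<noteq> u \<and> y \<noteq> u}\<^sup>*"
proof -
  have "(v, u) \<in> E" using assms(3) by (simp add: nbrs_def E_def insert_commute)
  then have "v \<noteq> u" using irrefl_E by (auto simp: irrefl_def)
  have "(v, u) \<in> (E - {(v, u), (u, v)})\<^sup>*"
    using detour[OF assms(1) \<open>(v, u) \<in> E\<close>] assms(2) by simp
  then obtain r where r: "(v, u) \<in> r\<^sup>*" "r = {(p, q) \<in> E - {(v, u), (u, v)}. p \<notin> {u}}"
    using rtrancl_first_hit[of v u _ "{u}"] by blast
  from r(1) obtain w where w: "(v, w) \<in> r\<^sup>*" "(w, u) \<in> r"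
    using \<open>v \<noteq> u\<close> by (meson rtranclE)
  have "w \<noteq> u \<longrightarrow> (v, w) \<in> {(x, y) \<in> E. x \<noteq> u \<and> y \<noteq> u}\<^sup>*"
    using w(1)
  proof (induction rule: rtrancl_induct)
    case (step p q)
    then show ?case using r(2) by (auto intro: rtrancl_into_rtrancl)
  qed simp
  moreover have "w \<in> nbrs u" "w \<noteq> v" "w \<noteq> u"
    using w(2) r(2) by (auto simp: nbrs_def E_def insert_commute)
  ultimately show ?thesis by blast
qed

text \<open>The oriented forest and the edges at \<open>u\<close>, directed to \<open>A\<close> and
  from the other neighbours, form a relation \<open>R\<close> in which every arc is on a closed walk
  through \<open>u\<close>. So some strong orientation extends \<open>R\<close> and keeps the
  required paths.\<close>

lemma oriented_diameter_le_undirected: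
  assumes "bridgeless G" "marcs G = {}" "u \<in> mverts G"
    and "card (mverts G) + 3 \<le> m + undirected_degree G u"
  shows "oriented_diameter G \<le> enat m"
proof -
  let ?E = "{(x, y) \<in> E. x \<noteq> u \<and> y \<noteq> u}"
  let ?N = "nbrs u"
  have symE: "sym ?E" using sym_E by (auto simp: sym_def)
  have partner: "\<And>v. v \<in> ?N \<Longrightarrow> \<exists>w\<in>?N. w \<noteq> v \<and> (v, w) \<in> ?E\<^sup>*"
    using undirected_partner[OF assms(1,2)] by blast
  obtain R0 A where R0: "R0 \<subseteq> ?E" "\<And>x y. (x, y) \<in> R0 \<Longrightarrow> (y, x) \<notin> R0" and A: "A \<subseteq> ?N"
    and out: "\<And>a. a \<in> A \<Longrightarrow> \<exists>b\<in>?N - A. \<exists>W. via R0 W a b \<and> W \<inter> ?N \<subseteq> {a, b}"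
    and into: "\<And>b. b \<in> ?N - A \<Longrightarrow> \<exists>a\<in>A. \<exists>W. via R0 W a b \<and> W \<inter> ?N \<subseteq> {a, b}"
    and cyc: "\<And>x y. (x, y) \<in> R0 \<Longrightarrow> (\<exists>a\<in>A. (a, x) \<in> R0\<^sup>*) \<and> (\<exists>b\<in>?N - A. (y, b) \<in> R0\<^sup>*)"
    by (rule alternating_orientation[of ?E ?N, OF symE partner]) (assumption, rule that, assumption+)
  define R where "R = R0 \<union> {u} \<times> A \<union> (?N - A) \<times> {u}"
  have N_E: "(u, v) \<in> E" "(v, u) \<in> E" "v \<noteq> u" if "v \<in> ?N" for v
    using that irrefl_E by (auto simp: nbrs_def E_def insert_commute irrefl_def)
  have R0R: "R0\<^sup>* \<subseteq> R\<^sup>*" by (rule rtrancl_mono) (auto simp: R_def)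
  have viaD: "(x, y) \<in> R\<^sup>*" if "via R0 W x y" for W x y
  proof -
    have "(R0 \<inter> W \<times> W)\<^sup>* \<subseteq> R0\<^sup>*" by (rule rtrancl_mono) auto
    then show ?thesis using that R0R by (auto simp: via_def)
  qed
  have to_u: "(b, u) \<in> R" if "b \<in> ?N - A" for b using that by (auto simp: R_def)
  have from_u: "(u, a) \<in> R" if "a \<in> A" for a using that by (auto simp: R_def)
  have uN: "u \<notin> ?N" "u \<notin> A" using N_E(3) A by blast+
  have RE: "R \<subseteq> E" using R0(1) A N_E by (auto simp: R_def)
  have anti: "(y, x) \<notin> R" if "(x, y) \<in> R" for x y
    using that R0 uN by (auto simp: R_def)
  have cycR: "(y, x) \<in> R\<^sup>*" if xy: "(x, y) \<in> R" for x y
  proof -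
    consider "(x, y) \<in> R0" | "x = u" "y \<in> A" | "y = u" "x \<in> ?N - A"
      using xy by (auto simp: R_def)
    then show ?thesis
    proof cases
      case 1
      then obtain a b where ab: "a \<in> A" "(a, x) \<in> R\<^sup>*" "b \<in> ?N - A" "(y, b) \<in> R\<^sup>*"
        using cyc R0R by blast
      have "(y, u) \<in> R\<^sup>*" using ab(4) to_u[OF ab(3)] by (rule rtrancl_into_rtrancl)
      moreover have "(u, x) \<in> R\<^sup>*" using from_u[OF ab(1)] ab(2) by (rule converse_rtrancl_into_rtrancl)
      ultimately show ?thesis by (rule rtrancl_trans)
    next
      case 2
      then obtain b W where "b \<in> ?N - A" "via R0 W y b" using out by blast
      then show ?thesis using 2 viaD to_u by (blast intro: rtrancl_into_rtrancl)
    next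
      case 3
      then obtain a W where "a \<in> A" "via R0 W a x" using into by blast
      then show ?thesis using 3 viaD from_u by (blast intro: converse_rtrancl_into_rtrancl)
    qed
  qed
  obtain T where T: "marcs G \<union> R \<subseteq> T" "T \<subseteq> marcs G \<union> E"
    "\<And>x y. (x, y) \<in> E \<Longrightarrow> ((x, y) \<in> T) \<noteq> ((y, x) \<in> T)"
    "\<And>x y. x \<in> mverts G \<Longrightarrow> y \<in> mverts G \<Longrightarrow> (x, y) \<in> T\<^sup>*"
    by (rule orientation_extending[OF assms(1) RE anti cycR]) (assumption, assumption, rule that, assumption+)
  show ?thesis
  proof (rule oriented_diameter_le_paired[OF _ T(2-4) assms(3) _ _ A out into assms(4)])
    show "marcs G \<subseteq> T" "R0 \<subseteq> T" using T(1) by (auto simp: R_def)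
    show "R0 \<subseteq> {(x, y). x \<noteq> u \<and> y \<noteq> u}" using R0(1) by auto
  qed
qed

end

theorem theorem1p3:
  fixes G :: "'a pre_mixed_graph" and u :: 'a and n :: nat
  assumes "mixed_graph G"
    and "bridgeless G"
    and "card (mverts G) = n"
    and "u \<in> mverts G"
  shows
    "(marcs G = {} \<or>
      out_arc_degree G u + in_arc_degree G u \<ge> 2 \<or>
      (undirected_degree G u = 5 \<and> out_arc_degree G u + in_arc_degree G u = 1)
        \<longrightarrow> oriented_diameter G \<le> enat (n - undirected_degree G u + 3)) \<and>
     (\<not> (marcs G = {} \<or>
         out_arc_degree G u + in_arc_degree G u \<ge> 2 \<or>
         (undirected_degree G u = 5 \<and> out_arc_degree G u + in_arc_degree G u = 1))
        \<longrightarrow> oriented_diameter G \<le> enat (n - undirected_degree G u + 4))"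
proof -
  interpret mixed_graph G by fact
  let ?d = "undirected_degree G u"
  have "?d < n" using undirected_degree_less_order assms(3,4) by blast
  then have m: "card (mverts G) + k \<le> n - ?d + k + ?d" for k using assms(3) by simp
  \<comment> \<open>With no direction prescribed, this yields a strong orientation for the bounds
    that start from an arbitrary one.\<close>
  obtain T where T: "marcs G \<union> {} \<subseteq> T" "T \<subseteq> marcs G \<union> E"
    "\<And>x y. (x, y) \<in> E \<Longrightarrow> ((x, y) \<in> T) \<noteq> ((y, x) \<in> T)"
    "\<And>x y. x \<in> mverts G \<Longrightarrow> y \<in> mverts G \<Longrightarrow> (x, y) \<in> T\<^sup>*"
    by (rule orientation_extending[OF assms(2) empty_subsetI]) (simp, simp, rule that, assumption+)
  have mT: "marcs G \<subseteq> T" using T(1) by simp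
  note strong = oriented_diameter_le_strong[OF mT T(2-4) assms(4) _ m]
    and general = oriented_diameter_le_general[OF mT T(2-4) assms(4) m]
  have "oriented_diameter G \<le> enat (n - ?d + 3)" if "marcs G = {}"
    using oriented_diameter_le_undirected[OF assms(2) that assms(4) m] .
  then show ?thesis using strong general by (auto simp: add.commute)
qed

end
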